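(* For every $k\in\mathbb Z$, $\Lambda_k$ is a smooth bounded function on $\mathbb R$ with $\Lambda_k(t)\to1$ as $t\to-\infty$ and $\Lambda_k(t)\to0$ as $t\to+\infty$, and the function $v_k(x,z):=r^{\frac12+3k}\Lambda_k(t)$, with $r=(z^2+x^{2/3})^{1/2}$ and $t=zx^{-1/3}$, satisfies $z\partial_xv_k-\partial_{zz}v_k=0$ in $(0,\infty)\times\mathbb R$ and $v_k(0,z)=0$ for $z>0$ (as a limit $x\to0^+$).
   Context: Let $M(a,b,\zeta)=\sum_{n\ge0}\frac{(a)_n}{(b)_n}\frac{\zeta^n}{n!}$ be Kummer's confluent hypergeometric function ($(a)_n$ the rising factorial). For $k\in\mathbb Z$ define $$\Lambda_k(t)=9^{\frac16+k}(1+t^2)^{-\frac14-\frac{3k}2}\Big[\tfrac{\Gamma(1/3)}{\Gamma(1/6-k)}M\big(-\tfrac16-k,\tfrac23,-\tfrac{t^3}{9}\big)-\tfrac{t}{9^{1/3}}\tfrac{\Gamma(-1/3)}{\Gamma(-1/6-k)}M\big(\tfrac16-k,\tfrac43,-\tfrac{t^3}{9}\big)\Big].$$ *)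

theory Defs
  imports "HOL-Analysis.Analysis"
begin

definition kummerM :: "real \<Rightarrow> real \<Rightarrow> real \<Rightarrow> real" where
  "kummerM a b \<zeta> = (\<Sum>n. pochhammer a n / pochhammer b n * \<zeta> ^ n / fact n)"

definition Lambda :: "int \<Rightarrow> real \<Rightarrow> real" where
  "Lambda k t =
     9 powr (1/6 + of_int k) * (1 + t^2) powr (-1/4 - 3 * of_int k / 2) *
     (Gamma (1/3) / Gamma (1/6 - of_int k) * kummerM (-1/6 - of_int k) (2/3) (- (t^3) / 9)
      - t / 9 powr (1/3) * (Gamma (-1/3) / Gamma (-1/6 - of_int k))
          * kummerM (1/6 - of_int k) (4/3) (- (t^3) / 9))"

definition vfun :: "int \<Rightarrow> real \<Rightarrow> real \<Rightarrow> real" where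
  "vfun k x z = sqrt (z^2 + x powr (2/3)) powr (1/2 + 3 * of_int k) * Lambda k (z * x powr (-1/3))"

definition smooth_real :: "(real \<Rightarrow> real) \<Rightarrow> bool" where
  "smooth_real f \<longleftrightarrow> (\<forall>n x. ((deriv ^^ n) f) differentiable (at x))"

end

theory Submission
  imports Defs "HOL-Real_Asymp.Real_Asymp"
begin

text \<open>
  Put \<open>a = -1/6 - k\<close>. Then \<open>\<Lambda>\<^sub>k(t) = 9\<^bsup>-a\<^esup> (1 + t\<^sup>2)\<^bsup>3a/2\<^esup> W(t)\<close> and \<open>v\<^sub>k(x,z) = 9\<^bsup>-a\<^esup> x\<^bsup>-a\<^esup> W(z x\<^bsup>-1/3\<^esup>)\<close>, where
  \<open>W\<close> is Tricomi's function \<open>U(a, 2/3, -t\<^sup>3/9)\<close>, continued through \<open>t = 0\<close>. Kummer's equation becomes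
  \<open>W'' + (t\<^sup>2/3) W' + a t W = 0\<close>, which is the differential equation for \<open>v\<^sub>k\<close>.

  All limits follow from \<open>M(a,b,x) \<sim> \<Gamma>(b)/\<Gamma>(a) e\<^sup>x x\<^bsup>a-b\<^esup>\<close> as \<open>x \<rightarrow> \<infinity>\<close>. The coefficients
  of \<open>M\<close> are asymptotic to those of \<open>\<Sum> (n+1)\<^sup>c x\<^sup>n/n!\<close> with \<open>c = a - b\<close>, up to the factor \<open>\<Gamma>(b)/\<Gamma>(a)\<close>.
  That this series is asymptotic to \<open>e\<^sup>x x\<^sup>c\<close> follows for integer \<open>c\<close> by shifting the summation index, and
  for real \<open>c\<close> because the quotient of the two is convex in \<open>c\<close>.

  As \<open>t \<rightarrow> +\<infinity>\<close>, Kummer's transformation yields the leading terms of the two solutions making up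
  \<open>W\<close>, and they cancel by the reflection formula. As \<open>t \<rightarrow> -\<infinity>\<close> the exponentially growing terms cancel,
  so \<open>U/M \<rightarrow> 0\<close>; the derivative of \<open>U/M\<close> is explicit, since the Wronskian is, and l'Hopital's rule
  recovers \<open>U(a,b,x) \<sim> x\<^bsup>-a\<^esup>\<close>.
\<close>

section \<open>Quotients of power series\<close>

lemma summable_power_series_bigo:
  fixes f g :: "nat \<Rightarrow> real"
  assumes "\<And>x. summable (\<lambda>n. g n * x ^ n)" and "f \<in> O(g)"
  shows "summable (\<lambda>n. f n * x ^ n)"
proof (rule summable_comparison_test_bigo)
  show "summable (\<lambda>n. norm (g n * x ^ n))"
    by (rule powser_insidea[where x = "\<bar>x\<bar> + 1"]) (use assms(1) in auto)
  show "(\<lambda>n. f n * x ^ n) \<in> O(\<lambda>n. g n * x ^ n)"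
    using assms(2) by (intro landau_o.big_mult) auto
qed

locale entire_nonneg_power_series =
  fixes g :: "nat \<Rightarrow> real"
  assumes nonneg: "0 \<le> g n"
    and eventually_pos: "\<forall>\<^sub>F n in sequentially. 0 < g n"
    and summable: "summable (\<lambda>n. g n * x ^ n)"
begin

lemma series_pos:
  assumes "0 < x"
  shows "0 < (\<Sum>n. g n * x ^ n)"
proof -
  obtain m where "0 < g m"
    using eventually_pos by (auto simp: eventually_sequentially)
  then show ?thesis
    using assms nonneg by (intro suminf_pos2[OF summable, of _ m]) auto
qed

lemma monomial_over_series_tendsto_0: "((\<lambda>x. x ^ k / (\<Sum>n. g n * x ^ n)) \<longlongrightarrow> 0) at_top"
proof -
  obtain N where "\<And>n. n \<ge> N \<Longrightarrow> 0 < g n"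
    using eventually_pos by (auto simp: eventually_sequentially)
  then obtain m where m: "k < m" "0 < g m"
    by (metis lessI max.cobounded1 max.cobounded2 order_less_le_trans)
  have bound: "x ^ k / (\<Sum>n. g n * x ^ n) \<le> 1 / (g m * x)" if x: "x \<ge> 1" for x
  proof -
    have "g m * x * x ^ k \<le> g m * x ^ m"
      using m x power_increasing[of "Suc k" m x] by simp
    also have "\<dots> \<le> (\<Sum>n. g n * x ^ n)"
      using sum_le_suminf[OF summable[of x], of "{m}"] nonneg x by simp
    finally show ?thesis
      using series_pos[of x] m x by (simp add: divide_simps mult_ac)
  qed
  show ?thesis
  proof (rule tendsto_sandwich[OF _ _ tendsto_const])
    show "\<forall>\<^sub>F x in at_top. 0 \<le> x ^ k / (\<Sum>n. g n * x ^ n)"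
      by (rule eventually_mono[OF eventually_gt_at_top[of 0]]) (simp add: series_pos less_imp_le)
    show "\<forall>\<^sub>F x in at_top. x ^ k / (\<Sum>n. g n * x ^ n) \<le> 1 / (g m * x)"
      using bound by (rule eventually_mono[OF eventually_ge_at_top[of 1]])
    show "((\<lambda>x. 1 / (g m * x)) \<longlongrightarrow> 0) at_top"
      using m(2) by real_asymp
  qed
qed

lemma abs_series_le:
  assumes "0 \<le> e" and d_le: "\<And>n. n \<ge> N \<Longrightarrow> \<bar>d n\<bar> \<le> e * g n" and x_nonneg: "0 \<le> x"
  shows "\<bar>\<Sum>n. d n * x ^ n\<bar> \<le> (\<Sum>n<N. \<bar>d n\<bar> * x ^ n) + e * (\<Sum>n. g n * x ^ n)"
proof -
  define p where "p n = (if n < N then \<bar>d n\<bar> * x ^ n else 0)" for n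
  have "p sums (\<Sum>n<N. \<bar>d n\<bar> * x ^ n)"
    using sums_If_finite_set[of "{..<N}" "\<lambda>n. \<bar>d n\<bar> * x ^ n"]
    by (simp add: p_def[abs_def])
  then have majorant: "(\<lambda>n. p n + e * (g n * x ^ n)) sums
      ((\<Sum>n<N. \<bar>d n\<bar> * x ^ n) + e * (\<Sum>n. g n * x ^ n))"
    by (intro sums_add sums_mult summable_sums summable)
  have term_le: "\<bar>d n * x ^ n\<bar> \<le> p n + e * (g n * x ^ n)" for n
  proof (cases "n < N")
    case True
    then show ?thesis
      using assms(1) x_nonneg nonneg[of n] by (simp add: p_def abs_mult)
  next
    case False
    then show ?thesis
      using mult_right_mono[OF d_le[of n], of "x ^ n"] x_nonneg by (simp add: p_def abs_mult mult.assoc)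
  qed
  have abs_summable: "summable (\<lambda>n. \<bar>d n * x ^ n\<bar>)"
    by (rule summable_comparison_test'[OF sums_summable[OF majorant], of 0]) (use term_le in auto)
  have "\<bar>\<Sum>n. d n * x ^ n\<bar> \<le> (\<Sum>n. \<bar>d n * x ^ n\<bar>)"
    by (rule summable_rabs[OF abs_summable])
  also have "\<dots> \<le> (\<Sum>n<N. \<bar>d n\<bar> * x ^ n) + e * (\<Sum>n. g n * x ^ n)"
    using sums_le[OF term_le summable_sums[OF abs_summable] majorant] .
  finally show ?thesis .
qed

lemma series_quotient_tendsto_0:
  assumes "d \<in> o(g)"
  shows "((\<lambda>x. (\<Sum>n. d n * x ^ n) / (\<Sum>n. g n * x ^ n)) \<longlongrightarrow> 0) at_top"
proof (rule tendstoI)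
  let ?G = "\<lambda>x. \<Sum>n. g n * x ^ n"
  fix e :: real assume e_pos: "e > 0"
  have "\<forall>\<^sub>F n in sequentially. \<bar>d n\<bar> \<le> e / 2 * g n"
    using landau_o.smallD[OF assms, of "e / 2"] e_pos nonneg by simp
  then obtain N where N: "\<And>n. n \<ge> N \<Longrightarrow> \<bar>d n\<bar> \<le> e / 2 * g n"
    by (auto simp: eventually_sequentially)
  have "((\<lambda>x. \<Sum>n<N. \<bar>d n\<bar> * (x ^ n / ?G x)) \<longlongrightarrow> (\<Sum>n<N. \<bar>d n\<bar> * 0)) at_top"
    by (intro tendsto_intros monomial_over_series_tendsto_0)
  then have "\<forall>\<^sub>F x in at_top. (\<Sum>n<N. \<bar>d n\<bar> * (x ^ n / ?G x)) < e / 2"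
    using e_pos by (intro order_tendstoD(2)) auto
  then show "\<forall>\<^sub>F x in at_top. dist ((\<Sum>n. d n * x ^ n) / ?G x) 0 < e"
    using eventually_gt_at_top[of 0]
  proof eventually_elim
    case (elim x)
    have "\<bar>(\<Sum>n. d n * x ^ n) / ?G x\<bar> \<le> ((\<Sum>n<N. \<bar>d n\<bar> * x ^ n) + e / 2 * ?G x) / ?G x"
      using abs_series_le[of "e / 2" N d x] N e_pos elim series_pos[of x] by (simp add: divide_right_mono)
    also have "\<dots> \<le> (\<Sum>n<N. \<bar>d n\<bar> * (x ^ n / ?G x)) + e / 2"
      using e_pos by (simp add: add_divide_distrib sum_divide_distrib)
    also have "\<dots> < e"
      using elim by simp
    finally show ?case by simp
  qed
qed

theorem series_quotient_tendsto:
  assumes ratio: "(\<lambda>n. f n / g n) \<longlonglongrightarrow> L"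
  shows "((\<lambda>x. (\<Sum>n. f n * x ^ n) / (\<Sum>n. g n * x ^ n)) \<longlongrightarrow> L) at_top"
proof -
  let ?G = "\<lambda>x. \<Sum>n. g n * x ^ n"
  have g_nonzero: "\<forall>\<^sub>F n in sequentially. g n \<noteq> 0"
    using eventually_pos by eventually_elim simp
  have summable_f: "summable (\<lambda>n. f n * x ^ n)" for x
    by (rule summable_power_series_bigo[OF summable bigoI_tendsto[OF ratio g_nonzero]])
  have "(\<lambda>n. (f n - L * g n) / g n) \<longlonglongrightarrow> 0"
  proof (rule Lim_transform_eventually)
    show "(\<lambda>n. f n / g n - L) \<longlonglongrightarrow> 0"
      using ratio by (simp add: LIM_zero)
    show "\<forall>\<^sub>F n in sequentially. f n / g n - L = (f n - L * g n) / g n"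
      using g_nonzero by eventually_elim (simp add: field_simps)
  qed
  then have "(\<lambda>n. f n - L * g n) \<in> o(g)"
    by (intro smalloI_tendsto g_nonzero)
  then have "((\<lambda>x. L + (\<Sum>n. (f n - L * g n) * x ^ n) / ?G x) \<longlongrightarrow> L + 0) at_top"
    by (intro tendsto_intros series_quotient_tendsto_0)
  moreover have "\<forall>\<^sub>F x in at_top. L + (\<Sum>n. (f n - L * g n) * x ^ n) / ?G x = (\<Sum>n. f n * x ^ n) / ?G x"
    using eventually_gt_at_top[of 0]
  proof eventually_elim
    case (elim x)
    have "(\<Sum>n. (f n - L * g n) * x ^ n) = (\<Sum>n. f n * x ^ n) - L * ?G x"
      using suminf_diff[OF summable_f summable_mult[OF summable], of x L x]
      by (simp add: left_diff_distrib mult.assoc suminf_mult summable)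
    then show ?case
      using series_pos[OF elim] by (simp add: field_simps)
  qed
  ultimately show ?thesis
    by (simp add: Lim_transform_eventually)
qed

end

section \<open>The series \<open>\<Sum> (n+1)\<^sup>c x\<^sup>n / n!\<close>\<close>

definition powr_exp_series :: "real \<Rightarrow> real \<Rightarrow> real" where
  "powr_exp_series c x = (\<Sum>n. real (n + 1) powr c / fact n * x ^ n)"

lemma summable_powr_exp_series:
  fixes c x :: real
  shows "summable (\<lambda>n. real (n + 1) powr c / fact n * x ^ n)"
proof (rule summable_power_series_bigo)
  show "summable (\<lambda>n. 2 ^ n / fact n * y ^ n)" for y :: real
    using summable_exp[of "2 * y"] by (simp add: power_mult_distrib divide_inverse mult_ac)
  have "(\<lambda>n. real (n + 1) powr c) \<in> O(\<lambda>n. 2 ^ n)"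
    by real_asymp
  then show "(\<lambda>n. real (n + 1) powr c / fact n) \<in> O(\<lambda>n. 2 ^ n / fact n)"
    by (intro landau_o.big.divide_right) auto
qed

interpretation powr_exp_series: entire_nonneg_power_series "\<lambda>n. real (n + 1) powr c / fact n" for c
proof unfold_locales
  show "summable (\<lambda>n. real (n + 1) powr c / fact n * x ^ n)" for x
    by (rule summable_powr_exp_series)
qed auto

lemma powr_exp_series_0: "powr_exp_series 0 x = exp x"
  by (simp add: powr_exp_series_def exp_def divide_inverse mult.commute)

lemma times_powr_exp_series:
  "x * powr_exp_series c x = (\<Sum>n. real n powr (c + 1) / fact n * x ^ n)"
proof -
  have "(\<lambda>n. x * (real (n + 1) powr c / fact n * x ^ n)) sums (x * powr_exp_series c x)"
    unfolding powr_exp_series_def by (intro sums_mult summable_sums summable_powr_exp_series)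
  moreover have "x * (real (n + 1) powr c / fact n * x ^ n)
      = real (Suc n) powr (c + 1) / fact (Suc n) * x ^ Suc n" for n
    by (simp add: powr_add divide_simps)
  ultimately have "(\<lambda>n. real (Suc n) powr (c + 1) / fact (Suc n) * x ^ Suc n) sums (x * powr_exp_series c x)"
    by simp
  then have "(\<lambda>n. real n powr (c + 1) / fact n * x ^ n) sums (x * powr_exp_series c x)"
    \<comment> \<open>the term for \<open>n = 0\<close> is 0, because \<open>0 powr y = 0\<close> for every \<open>y\<close>\<close>
    by (subst (asm) sums_Suc_iff) simp
  then show ?thesis
    by (simp add: sums_iff)
qed

lemma powr_exp_series_plus_1_asymp_equiv:
  "powr_exp_series (c + 1) \<sim>[at_top] (\<lambda>x. x * powr_exp_series c x)"
proof (rule asymp_equiv_symI, rule asymp_equivI')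
  have "(\<lambda>n. (real n powr (c + 1) / fact n) / (real (n + 1) powr (c + 1) / fact n)) \<longlonglongrightarrow> 1"
  proof -
    have "(\<lambda>n. real n powr (c + 1) / real (n + 1) powr (c + 1)) \<longlonglongrightarrow> 1"
      by real_asymp
    then show ?thesis by simp
  qed
  from powr_exp_series.series_quotient_tendsto[OF this]
  show "((\<lambda>x. x * powr_exp_series c x / powr_exp_series (c + 1) x) \<longlongrightarrow> 1) at_top"
    unfolding times_powr_exp_series unfolding powr_exp_series_def .
qed

lemma powr_exp_series_asymp_equiv_int:
  "powr_exp_series (of_int m) \<sim>[at_top] (\<lambda>x. exp x * x powr of_int m)"
proof (induction m rule: int_induct[where k = 0])
  case base
  show ?case
    by (rule asymp_equiv_refl_ev, rule eventually_mono[OF eventually_gt_at_top[of 0]])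
       (simp add: powr_exp_series_0)
next
  case (step1 m)
  have "powr_exp_series (of_int m + 1) \<sim>[at_top] (\<lambda>x. x * powr_exp_series (of_int m) x)"
    by (rule powr_exp_series_plus_1_asymp_equiv)
  also have "\<dots> \<sim>[at_top] (\<lambda>x. x * (exp x * x powr of_int m))"
    by (intro asymp_equiv_mult asymp_equiv_refl step1)
  also have "\<dots> \<sim>[at_top] (\<lambda>x. exp x * x powr (of_int m + 1))"
    by real_asymp
  finally show ?case by simp
next
  case (step2 m)
  have "powr_exp_series (of_int m - 1) \<sim>[at_top] (\<lambda>x. x * powr_exp_series (of_int m - 1) x / x)"
    by (rule asymp_equiv_refl_ev, rule eventually_mono[OF eventually_gt_at_top[of 0]]) simp
  also have "\<dots> \<sim>[at_top] (\<lambda>x. powr_exp_series (of_int m) x / x)"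
    using powr_exp_series_plus_1_asymp_equiv[of "of_int m - 1"]
    by (intro asymp_equiv_divide asymp_equiv_refl) (simp add: asymp_equiv_sym)
  also have "\<dots> \<sim>[at_top] (\<lambda>x. exp x * x powr of_int m / x)"
    by (intro asymp_equiv_divide asymp_equiv_refl step2)
  also have "\<dots> \<sim>[at_top] (\<lambda>x. exp x * x powr (of_int m - 1))"
    by real_asymp
  finally show ?case by simp
qed

lemma powr_convex_in_exponent:
  fixes y :: real
  assumes "y > 0"
  shows "convex_on UNIV (\<lambda>c. y powr c)"
proof (rule convex_onI)
  fix t u v :: real assume "0 < t" "t < 1"
  then show "y powr ((1 - t) *\<^sub>R u + t *\<^sub>R v) \<le> (1 - t) * y powr u + t * y powr v"
    using convex_onD[OF exp_convex, of t "u * ln y" "v * ln y"] assms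
    by (simp add: powr_def algebra_simps)
qed simp

text \<open>The quotient is the \<open>c\<close>-th moment of \<open>(N + 1) / x\<close> for a Poisson variable \<open>N\<close> of mean \<open>x\<close>.\<close>

lemma normalized_powr_exp_series_convex:
  assumes "x > 0"
  shows "convex_on UNIV (\<lambda>c. powr_exp_series c x / (exp x * x powr c))"
proof (rule convex_onI)
  define w where "w n = x ^ n / fact n / exp x" for n
  have w_nonneg: "w n \<ge> 0" for n
    using assms by (simp add: w_def)
  have sums: "(\<lambda>n. (real (n + 1) / x) powr c * w n) sums (powr_exp_series c x / (exp x * x powr c))" for c
  proof -
    have "(\<lambda>n. real (n + 1) powr c / fact n * x ^ n / (exp x * x powr c)) sums
        (powr_exp_series c x / (exp x * x powr c))"
      unfolding powr_exp_series_def by (intro sums_divide summable_sums summable_powr_exp_series)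
    moreover have "(real (n + 1) / x) powr c = real (n + 1) powr c / x powr c" for n
      by (rule powr_divide)
    ultimately show ?thesis
      by (simp add: w_def mult_ac)
  qed
  fix t u v :: real assume t: "0 < t" "t < 1"
  show "powr_exp_series ((1 - t) *\<^sub>R u + t *\<^sub>R v) x / (exp x * x powr ((1 - t) *\<^sub>R u + t *\<^sub>R v))
      \<le> (1 - t) * (powr_exp_series u x / (exp x * x powr u)) + t * (powr_exp_series v x / (exp x * x powr v))"
  proof (rule sums_le[OF _ sums sums_add[OF sums_mult[OF sums] sums_mult[OF sums]]])
    fix n
    have "real (n + 1) / x > 0"
      using assms by simp
    from convex_onD[OF powr_convex_in_exponent[OF this], of t u v]
    have "(real (n + 1) / x) powr ((1 - t) *\<^sub>R u + t *\<^sub>R v)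
        \<le> (1 - t) * (real (n + 1) / x) powr u + t * (real (n + 1) / x) powr v"
      using t by simp
    from mult_right_mono[OF this w_nonneg[of n]]
    show "(real (n + 1) / x) powr ((1 - t) *\<^sub>R u + t *\<^sub>R v) * w n
        \<le> (1 - t) * ((real (n + 1) / x) powr u * w n) + t * ((real (n + 1) / x) powr v * w n)"
      by (simp add: distrib_right mult.assoc)
  qed
qed simp

lemma convex_on_floor_bounds:
  fixes f :: "real \<Rightarrow> real"
  assumes "convex_on UNIV f"
  shows "f c \<le> (1 - frac c) * f (of_int \<lfloor>c\<rfloor>) + frac c * f (of_int \<lfloor>c\<rfloor> + 1)" (is ?upper)
    and "(1 + frac c) * f (of_int \<lfloor>c\<rfloor>) - frac c * f (of_int \<lfloor>c\<rfloor> - 1) \<le> f c" (is ?lower)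
proof -
  define t m where "t = frac c" and "m = real_of_int \<lfloor>c\<rfloor>"
  have t_bounds: "0 \<le> t" "t \<le> 1"
    using frac_lt_1[of c] by (simp_all add: t_def)
  have c_eq: "c = m + t"
    by (simp add: t_def m_def frac_def)
  have "(1 - t) * m + t * (m + 1) = c"
    by (simp add: c_eq algebra_simps)
  then show ?upper
    using convex_onD[OF assms t_bounds, of m "m + 1"] by (simp flip: t_def m_def)
  define u where "u = 1 / (1 + t)"
  have u_bounds: "0 \<le> u" "u \<le> 1" and u_times: "u * (1 + t) = 1"
    using t_bounds by (simp_all add: u_def)
  have "(1 - u) * (m - 1) + u * c = m - 1 + u * (1 + t)"
    by (simp add: c_eq algebra_simps)
  then have "f m \<le> (1 - u) * f (m - 1) + u * f c"
    using convex_onD[OF assms u_bounds, of "m - 1" c] u_times by simp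
  then have "(1 + t) * f m \<le> (1 + t) * ((1 - u) * f (m - 1) + u * f c)"
    using t_bounds by (intro mult_left_mono) auto
  also have "\<dots> = (1 + t - u * (1 + t)) * f (m - 1) + (u * (1 + t)) * f c"
    by (simp add: algebra_simps)
  finally show ?lower
    using u_times by (simp flip: t_def m_def)
qed

lemma tendsto_if_convex_and_tendsto_on_ints:
  fixes F :: "'a \<Rightarrow> real \<Rightarrow> real"
  assumes convex: "\<forall>\<^sub>F x in G. convex_on UNIV (F x)"
    and lim: "\<And>m :: int. ((\<lambda>x. F x (of_int m)) \<longlongrightarrow> L) G"
  shows "((\<lambda>x. F x c) \<longlongrightarrow> L) G"
proof (rule tendsto_sandwich)
  define t m where "t = frac c" and "m = real_of_int \<lfloor>c\<rfloor>"
  have lims: "((\<lambda>x. F x (m - 1)) \<longlongrightarrow> L) G" "((\<lambda>x. F x m) \<longlongrightarrow> L) G" "((\<lambda>x. F x (m + 1)) \<longlongrightarrow> L) G"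
    using lim[of "\<lfloor>c\<rfloor> - 1"] lim[of "\<lfloor>c\<rfloor>"] lim[of "\<lfloor>c\<rfloor> + 1"] by (simp_all add: m_def)
  show "\<forall>\<^sub>F x in G. (1 + t) * F x m - t * F x (m - 1) \<le> F x c"
    "\<forall>\<^sub>F x in G. F x c \<le> (1 - t) * F x m + t * F x (m + 1)"
    using convex unfolding t_def m_def by (auto elim!: eventually_mono intro: convex_on_floor_bounds)
  have "((\<lambda>x. (1 + t) * F x m - t * F x (m - 1)) \<longlongrightarrow> (1 + t) * L - t * L) G"
    by (intro tendsto_intros lims)
  then show "((\<lambda>x. (1 + t) * F x m - t * F x (m - 1)) \<longlongrightarrow> L) G"
    by (simp add: algebra_simps)
  have "((\<lambda>x. (1 - t) * F x m + t * F x (m + 1)) \<longlongrightarrow> (1 - t) * L + t * L) G"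
    by (intro tendsto_intros lims)
  then show "((\<lambda>x. (1 - t) * F x m + t * F x (m + 1)) \<longlongrightarrow> L) G"
    by (simp add: algebra_simps)
qed

theorem powr_exp_series_asymp_equiv: "powr_exp_series c \<sim>[at_top] (\<lambda>x. exp x * x powr c)"
proof (rule asymp_equivI')
  show "((\<lambda>x. powr_exp_series c x / (exp x * x powr c)) \<longlongrightarrow> 1) at_top"
  proof (rule tendsto_if_convex_and_tendsto_on_ints[where c = c])
    show "\<forall>\<^sub>F x in at_top. convex_on UNIV (\<lambda>c. powr_exp_series c x / (exp x * x powr c))"
      using normalized_powr_exp_series_convex by (rule eventually_mono[OF eventually_gt_at_top[of 0]])
    show "((\<lambda>x. powr_exp_series (of_int m) x / (exp x * x powr of_int m)) \<longlongrightarrow> 1) at_top" for m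
      using powr_exp_series_asymp_equiv_int
    proof (rule asymp_equivD_strong)
      show "\<forall>\<^sub>F x in at_top. powr_exp_series (of_int m) x \<noteq> 0 \<or> exp x * x powr of_int m \<noteq> 0"
        by (rule eventually_mono[OF eventually_gt_at_top[of 0]]) simp
    qed
  qed
qed

section \<open>Kummer's function\<close>

lemma pochhammer_ratio_asymp:
  fixes a b :: real
  assumes "b \<notin> \<int>\<^sub>\<le>\<^sub>0"
  shows "(\<lambda>n. pochhammer a n / pochhammer b n / real (n + 1) powr (a - b)) \<longlonglongrightarrow> Gamma b * rGamma a"
proof (rule LIMSEQ_imp_Suc)
  have "(\<lambda>n. (Gamma_series b n * rGamma_series a n) * (real n / real (n + 2)) powr (a - b))
      \<longlonglongrightarrow> (Gamma b * rGamma a) * 1"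
  proof (intro tendsto_mult)
    show "(\<lambda>n. (real n / real (n + 2)) powr (a - b)) \<longlonglongrightarrow> 1"
      by real_asymp
  qed (rule Gamma_series_LIMSEQ rGamma_series_LIMSEQ)+
  moreover have "\<forall>\<^sub>F n in sequentially.
      (Gamma_series b n * rGamma_series a n) * (real n / real (n + 2)) powr (a - b)
      = pochhammer a (Suc n) / pochhammer b (Suc n) / real (Suc n + 1) powr (a - b)"
    using eventually_gt_at_top[of 0]
  proof eventually_elim
    case (elim n)
    have "exp (b * ln (real n)) = real n powr b" "exp (a * ln (real n)) = real n powr a"
      using elim by (auto simp: powr_def)
    moreover have "(real n / real (n + 2)) powr (a - b)
        = real n powr a / real n powr b / real (n + 2) powr (a - b)"
      by (subst powr_divide) (simp add: powr_diff)
    ultimately show ?case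
      using elim by (simp add: Gamma_series_def rGamma_series_def)
  qed
  ultimately show "(\<lambda>n. pochhammer a (Suc n) / pochhammer b (Suc n) / real (Suc n + 1) powr (a - b))
      \<longlonglongrightarrow> Gamma b * rGamma a"
    by (simp add: Lim_transform_eventually)
qed

definition kummer_coeff :: "real \<Rightarrow> real \<Rightarrow> nat \<Rightarrow> real" where
  "kummer_coeff a b n = pochhammer a n / pochhammer b n / fact n"

lemma kummerM_altdef: "kummerM a b x = (\<Sum>n. kummer_coeff a b n * x ^ n)"
  by (simp add: kummerM_def kummer_coeff_def)

lemma kummer_coeff_Suc:
  assumes "b \<notin> \<int>\<^sub>\<le>\<^sub>0"
  shows "(b + real n) * (real (Suc n) * kummer_coeff a b (Suc n)) = (a + real n) * kummer_coeff a b n"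
proof -
  have "pochhammer b (Suc n) \<noteq> 0"
    using assms pochhammer_eq_0_imp_nonpos_Int by blast
  then show ?thesis
    by (simp add: kummer_coeff_def pochhammer_Suc divide_simps del: of_nat_Suc)
qed

lemma diffs_kummer_coeff:
  "diffs (kummer_coeff a b) n = a / b * kummer_coeff (a + 1) (b + 1) n"
  by (simp add: diffs_def kummer_coeff_def pochhammer_rec divide_simps del: of_nat_Suc)

lemma kummer_coeff_ratio_tendsto:
  assumes "b \<notin> \<int>\<^sub>\<le>\<^sub>0"
  shows "(\<lambda>n. kummer_coeff a b n / (real (n + 1) powr (a - b) / fact n)) \<longlonglongrightarrow> Gamma b * rGamma a"
  using pochhammer_ratio_asymp[OF assms, of a] by (simp add: kummer_coeff_def)

lemma summable_kummer_coeff: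
  assumes "b \<notin> \<int>\<^sub>\<le>\<^sub>0"
  shows "summable (\<lambda>n. kummer_coeff a b n * x ^ n)"
proof (rule summable_power_series_bigo[OF summable_powr_exp_series])
  show "kummer_coeff a b \<in> O(\<lambda>n. real (n + 1) powr (a - b) / fact n)"
    using kummer_coeff_ratio_tendsto[OF assms] by (rule bigoI_tendsto) simp
qed

lemma kummerM_sums:
  assumes "b \<notin> \<int>\<^sub>\<le>\<^sub>0"
  shows "(\<lambda>n. kummer_coeff a b n * x ^ n) sums kummerM a b x"
  unfolding kummerM_altdef by (intro summable_sums summable_kummer_coeff assms)

lemma kummerM_0: "kummerM a b 0 = 1"
  using powser_sums_zero[of "kummer_coeff a b"] by (simp add: kummerM_altdef sums_iff kummer_coeff_def)

theorem kummerM_at_top: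
  assumes "b \<notin> \<int>\<^sub>\<le>\<^sub>0"
  shows "((\<lambda>x. kummerM a b x / (exp x * x powr (a - b))) \<longlongrightarrow> Gamma b * rGamma a) at_top"
proof -
  have "((\<lambda>x. kummerM a b x / powr_exp_series (a - b) x) \<longlongrightarrow> Gamma b * rGamma a) at_top"
    unfolding kummerM_altdef powr_exp_series_def
    by (rule powr_exp_series.series_quotient_tendsto[OF kummer_coeff_ratio_tendsto[OF assms]])
  moreover have "(\<lambda>x. kummerM a b x / powr_exp_series (a - b) x)
      \<sim>[at_top] (\<lambda>x. kummerM a b x / (exp x * x powr (a - b)))"
    by (intro asymp_equiv_divide asymp_equiv_refl powr_exp_series_asymp_equiv)
  ultimately show ?thesis
    using tendsto_asymp_equiv_cong by blast
qed

lemma kummer_coeff_convolution: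
  fixes a b :: real
  assumes "b \<notin> \<int>\<^sub>\<le>\<^sub>0"
  shows "(\<Sum>i\<le>n. kummer_coeff (b - a) b i * ((- 1) ^ (n - i) / fact (n - i))) = (- 1) ^ n * kummer_coeff a b n"
proof -
  have "kummer_coeff (b - a) b i * ((- 1) ^ (n - i) / fact (n - i)) = (- 1) ^ n / fact n
      * (pochhammer (b - a) i * pochhammer (- of_nat n) i / (of_nat (fact i) * pochhammer b i))"
    if "i \<le> n" for i
  proof -
    have "fact n = (fact (n - i) * pochhammer (1 + real (n - i)) i :: real)"
      using pochhammer_product[of "n - i" n "1 :: real"] that by (simp add: pochhammer_fact)
    then have "pochhammer (- real n) i = (- 1) ^ i * fact n / fact (n - i)"
      using that by (simp add: pochhammer_minus add_ac)
    moreover have "(- 1 :: real) ^ (n - i) = (- 1) ^ n * (- 1) ^ i"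
      using that by (simp add: neg_one_power_add_eq_neg_one_power_diff flip: power_add)
    ultimately show ?thesis
      by (simp add: kummer_coeff_def mult_ac)
  qed
  then have "(\<Sum>i\<le>n. kummer_coeff (b - a) b i * ((- 1) ^ (n - i) / fact (n - i))) = (- 1) ^ n / fact n
      * (\<Sum>i=0..n. pochhammer (b - a) i * pochhammer (- of_nat n) i / (of_nat (fact i) * pochhammer b i))"
    by (simp add: sum_distrib_left atLeast0AtMost)
  also have "(\<Sum>i=0..n. pochhammer (b - a) i * pochhammer (- of_nat n) i / (of_nat (fact i) * pochhammer b i))
      = pochhammer a n / pochhammer b n"
    using Vandermonde_pochhammer[of n b "b - a"] assms by force
  finally show ?thesis
    by (simp add: kummer_coeff_def)
qed

theorem kummer_transformation:
  assumes "b \<notin> \<int>\<^sub>\<le>\<^sub>0"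
  shows "kummerM a b (- x) = exp (- x) * kummerM (b - a) b x"
proof -
  let ?u = "\<lambda>n. kummer_coeff (b - a) b n * x ^ n"
  let ?v = "\<lambda>n. (- 1) ^ n / fact n * x ^ n"
  have exp_term: "(- 1) ^ n / fact n * x ^ n = (- x) ^ n /\<^sub>R fact n" for n
    by (simp add: divide_inverse power_minus[of x] mult_ac)
  have "summable (\<lambda>n. norm (?u n))"
    by (rule powser_insidea[where x = "\<bar>x\<bar> + 1"]) (use summable_kummer_coeff[OF assms] in auto)
  moreover have "summable (\<lambda>n. norm (?v n))"
    unfolding exp_term by (rule summable_norm_exp)
  ultimately have "(\<lambda>n. \<Sum>i\<le>n. ?u i * ?v (n - i)) sums ((\<Sum>n. ?u n) * (\<Sum>n. ?v n))"
    by (rule Cauchy_product_sums)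
  moreover have "(\<Sum>n. ?v n) = exp (- x)"
    unfolding exp_term exp_def ..
  moreover have "(\<Sum>i\<le>n. ?u i * ?v (n - i)) = kummer_coeff a b n * (- x) ^ n" for n
  proof -
    have "(\<Sum>i\<le>n. ?u i * ?v (n - i))
        = (\<Sum>i\<le>n. kummer_coeff (b - a) b i * ((- 1) ^ (n - i) / fact (n - i)) * x ^ n)"
    proof (rule sum.cong)
      fix i assume "i \<in> {..n}"
      then have "x ^ n = x ^ i * x ^ (n - i)"
        by (simp flip: power_add)
      then show "?u i * ?v (n - i) = kummer_coeff (b - a) b i * ((- 1) ^ (n - i) / fact (n - i)) * x ^ n"
        by simp
    qed simp
    also have "\<dots> = (\<Sum>i\<le>n. kummer_coeff (b - a) b i * ((- 1) ^ (n - i) / fact (n - i))) * x ^ n"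
      by (simp only: sum_distrib_right)
    finally show ?thesis
      using kummer_coeff_convolution[OF assms, of a n] power_minus[of x n] by simp
  qed
  ultimately show ?thesis
    by (simp add: kummerM_altdef sums_iff mult.commute)
qed

lemma kummerM_minus_at_top:
  assumes "b \<notin> \<int>\<^sub>\<le>\<^sub>0"
  shows "((\<lambda>x. kummerM a b (- x) * x powr a) \<longlongrightarrow> Gamma b * rGamma (b - a)) at_top"
proof -
  have "kummerM (b - a) b x / (exp x * x powr (b - a - b)) = kummerM a b (- x) * x powr a" for x
    using kummer_transformation[OF assms, of a x] by (simp add: exp_minus powr_minus field_simps)
  then show ?thesis
    using kummerM_at_top[OF assms, of "b - a"] by simp
qed

lemma has_real_derivative_kummerM_diffs:
  assumes "b \<notin> \<int>\<^sub>\<le>\<^sub>0"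
  shows "(kummerM a b has_real_derivative (\<Sum>n. diffs (kummer_coeff a b) n * x ^ n)) (at x)"
proof -
  have "kummerM a b = (\<lambda>x. \<Sum>n. kummer_coeff a b n * x ^ n)"
    by (rule ext) (rule kummerM_altdef)
  then show ?thesis
    using termdiffs_strong_converges_everywhere[OF summable_kummer_coeff[OF assms]] by simp
qed

lemma has_real_derivative_kummerM:
  assumes "b \<notin> \<int>\<^sub>\<le>\<^sub>0"
  shows "(kummerM a b has_real_derivative a / b * kummerM (a + 1) (b + 1) x) (at x)"
proof -
  have "b + 1 \<notin> \<int>\<^sub>\<le>\<^sub>0"
    using plus_one_in_nonpos_Ints_imp assms by blast
  from sums_mult[OF kummerM_sums[OF this]]
  have "(\<lambda>n. diffs (kummer_coeff a b) n * x ^ n) sums (a / b * kummerM (a + 1) (b + 1) x)"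
    by (simp only: diffs_kummer_coeff mult.assoc)
  then show ?thesis
    using has_real_derivative_kummerM_diffs[OF assms, of a x] by (simp add: sums_iff)
qed

lemma deriv_kummerM:
  assumes "b \<notin> \<int>\<^sub>\<le>\<^sub>0"
  shows "deriv (kummerM a b) = (\<lambda>x. a / b * kummerM (a + 1) (b + 1) x)"
  using has_real_derivative_kummerM[OF assms] by (intro ext DERIV_imp_deriv)

lemma kummerM_has_deriv:
  assumes "b \<notin> \<int>\<^sub>\<le>\<^sub>0"
  shows "(kummerM a b has_real_derivative deriv (kummerM a b) x) (at x)"
    and "(deriv (kummerM a b) has_real_derivative deriv (deriv (kummerM a b)) x) (at x)"
proof -
  have "b + 1 \<notin> \<int>\<^sub>\<le>\<^sub>0"
    using plus_one_in_nonpos_Ints_imp assms by blast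
  then have "(\<lambda>x. a / b * kummerM (a + 1) (b + 1) x) differentiable (at x)"
    using DERIV_cmult[OF has_real_derivative_kummerM] real_differentiable_def by blast
  then show "(deriv (kummerM a b) has_real_derivative deriv (deriv (kummerM a b)) x) (at x)"
    unfolding deriv_kummerM[OF assms] by (simp add: DERIV_deriv_iff_real_differentiable)
  show "(kummerM a b has_real_derivative deriv (kummerM a b) x) (at x)"
    using has_real_derivative_kummerM[OF assms] by (simp add: deriv_kummerM[OF assms])
qed

lemma sums_times_diffs:
  fixes c :: "nat \<Rightarrow> real"
  assumes "\<And>x. summable (\<lambda>n. c n * x ^ n)"
  shows "(\<lambda>n. real n * c n * x ^ n) sums (x * (\<Sum>n. diffs c n * x ^ n))"
proof -
  have "(\<lambda>n. x * (real n * c n * x ^ (n - Suc 0))) sums (x * (\<Sum>n. diffs c n * x ^ n))"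
    by (intro sums_mult diffs_equiv termdiff_converges_all assms)
  moreover have "x * (real n * c n * x ^ (n - Suc 0)) = real n * c n * x ^ n" for n
    by (cases n) simp_all
  ultimately show ?thesis by simp
qed

theorem kummer_equation:
  assumes "b \<notin> \<int>\<^sub>\<le>\<^sub>0"
  shows "x * deriv (deriv (kummerM a b)) x + (b - x) * deriv (kummerM a b) x = a * kummerM a b x"
proof -
  let ?c = "kummer_coeff a b"
  have summable_coeff: "summable (\<lambda>n. ?c n * x ^ n)" for x
    by (rule summable_kummer_coeff[OF assms])
  then have summable_diffs: "summable (\<lambda>n. diffs ?c n * x ^ n)" for x
    by (rule termdiff_converges_all)
  have deriv_eq: "deriv (kummerM a b) = (\<lambda>x. \<Sum>n. diffs ?c n * x ^ n)"
    using has_real_derivative_kummerM_diffs[OF assms] by (intro ext DERIV_imp_deriv)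
  have deriv2_eq: "deriv (deriv (kummerM a b)) x = (\<Sum>n. diffs (diffs ?c) n * x ^ n)"
    unfolding deriv_eq using summable_diffs by (intro DERIV_imp_deriv termdiffs_strong_converges_everywhere)
  have "(\<lambda>n. real n * diffs ?c n * x ^ n + b * (diffs ?c n * x ^ n)
        - real n * ?c n * x ^ n - a * (?c n * x ^ n))
      sums (x * deriv (deriv (kummerM a b)) x + b * deriv (kummerM a b) x - x * deriv (kummerM a b) x
        - a * kummerM a b x)"
    unfolding deriv2_eq unfolding deriv_eq kummerM_altdef
    by (intro sums_add sums_diff sums_mult summable_sums summable_coeff summable_diffs sums_times_diffs)
  moreover have "real n * diffs ?c n * x ^ n + b * (diffs ?c n * x ^ n)
        - real n * ?c n * x ^ n - a * (?c n * x ^ n)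
      = ((b + real n) * (real (Suc n) * ?c (Suc n)) - (a + real n) * ?c n) * x ^ n" for n
    by (simp add: diffs_def algebra_simps del: of_nat_Suc)
  ultimately have "(\<lambda>n. 0) sums (x * deriv (deriv (kummerM a b)) x + b * deriv (kummerM a b) x
      - x * deriv (kummerM a b) x - a * kummerM a b x)"
    by (simp add: kummer_coeff_Suc[OF assms] del: of_nat_Suc)
  then show ?thesis
    using sums_unique2[OF sums_zero] by (fastforce simp: left_diff_distrib)
qed

section \<open>Tricomi's function\<close>

definition kummer_second_solution :: "real \<Rightarrow> real \<Rightarrow> real \<Rightarrow> real" where
  "kummer_second_solution a b x = x powr (1 - b) * kummerM (a - b + 1) (2 - b) x"

definition tricomiU :: "real \<Rightarrow> real \<Rightarrow> real \<Rightarrow> real" where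
  "tricomiU a b x = Gamma (1 - b) * rGamma (a - b + 1) * kummerM a b x
     + Gamma (b - 1) * rGamma a * kummer_second_solution a b x"

lemma notin_Ints_imp_notin_nonpos_Ints:
  fixes b :: real
  assumes "b \<notin> \<int>"
  shows "b \<notin> \<int>\<^sub>\<le>\<^sub>0" "2 - b \<notin> \<int>\<^sub>\<le>\<^sub>0" "b - 1 \<notin> \<int>\<^sub>\<le>\<^sub>0" "1 - b \<notin> \<int>\<^sub>\<le>\<^sub>0"
  using assms nonpos_Ints_subset_Ints Ints_diff[of 2 "2 - b"] Ints_add[of "b - 1" 1]
    Ints_diff[of 1 "1 - b"] by auto

text \<open>
  Multiplied by \<open>x\<^bsup>-b\<^esup>\<close>, this is the Wronskian of the two solutions. Without that factor the identity
  extends to \<open>x = 0\<close>, where its constant is read off.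
\<close>

lemma kummerM_wronskian:
  assumes "b \<notin> \<int>"
  shows "kummerM a b x *
      ((1 - b) * kummerM (a - b + 1) (2 - b) x + x * deriv (kummerM (a - b + 1) (2 - b)) x)
    - x * deriv (kummerM a b) x * kummerM (a - b + 1) (2 - b) x = (1 - b) * exp x"
proof -
  note b_notin = notin_Ints_imp_notin_nonpos_Ints[OF assms]
  define M K where "M = kummerM a b" and "K = kummerM (a - b + 1) (2 - b)"
  define D where "D x = (M x * ((1 - b) * K x + x * deriv K x) - x * deriv M x * K x) * exp (- x)" for x
  note has_derivs = kummerM_has_deriv[OF b_notin(1), of a, folded M_def]
    kummerM_has_deriv[OF b_notin(2), of "a - b + 1", folded K_def]
  have "(D has_real_derivative 0) (at x)" for x
  proof -
    have "(D has_real_derivative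
        (M x * (x * deriv (deriv K) x + (2 - b - x) * deriv K x - (a - b + 1) * K x)
         - K x * (x * deriv (deriv M) x + (b - x) * deriv M x - a * M x)) * exp (- x)) (at x)"
      unfolding D_def by (auto intro!: derivative_eq_intros has_derivs simp: algebra_simps)
    then show ?thesis
      using kummer_equation[OF b_notin(1), of x a] kummer_equation[OF b_notin(2), of x "a - b + 1"]
      by (simp add: M_def K_def)
  qed
  then have "D x = D 0"
    by (intro DERIV_isconst_all) blast
  then show ?thesis
    by (simp add: D_def M_def K_def kummerM_0 exp_minus field_simps)
qed

lemma kummer_second_solution_has_derivative:
  fixes a b :: real
  defines "K \<equiv> kummerM (a - b + 1) (2 - b)"
  assumes "b \<notin> \<int>" and "x > 0"
  shows "(kummer_second_solution a b has_real_derivative x powr (- b) * ((1 - b) * K x + x * deriv K x)) (at x)"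
proof -
  note K_deriv = kummerM_has_deriv(1)[OF notin_Ints_imp_notin_nonpos_Ints(2), OF assms(2), of "a - b + 1",
      folded K_def]
  have "x powr (1 - b) = x * x powr (- b)"
    using assms(3) powr_add[of x 1 "- b"] by simp
  then have "((\<lambda>x. x powr (1 - b) * K x) has_real_derivative
      x powr (- b) * ((1 - b) * K x + x * deriv K x)) (at x)"
    using assms(3) by (auto intro!: derivative_eq_intros K_deriv simp: algebra_simps)
  then show ?thesis
    by (simp add: kummer_second_solution_def[abs_def] K_def)
qed

lemma tricomiU_over_kummerM_has_derivative:
  assumes b_notin_Ints: "b \<notin> \<int>" and x: "x > 0" "kummerM a b x \<noteq> 0"
  shows "((\<lambda>x. tricomiU a b x / kummerM a b x) has_real_derivative
    - (Gamma b * rGamma a) * exp x * x powr (- b) / (kummerM a b x)\<^sup>2) (at x)"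
proof -
  define M N K where "M = kummerM a b" and "N = kummer_second_solution a b" and "K = kummerM (a - b + 1) (2 - b)"
  define N' where "N' = x powr (- b) * ((1 - b) * K x + x * deriv K x)"
  have M_deriv: "(M has_real_derivative deriv M x) (at x)"
    unfolding M_def by (rule kummerM_has_deriv[OF notin_Ints_imp_notin_nonpos_Ints(1)[OF b_notin_Ints]])
  have N_deriv: "(N has_real_derivative N') (at x)"
    unfolding N_def N'_def K_def by (rule kummer_second_solution_has_derivative[OF b_notin_Ints x(1)])
  have "x powr (- b) * (M x * ((1 - b) * K x + x * deriv K x) - x * deriv M x * K x)
      = (1 - b) * exp x * x powr (- b)"
    using kummerM_wronskian[OF b_notin_Ints, of a x] by (simp add: M_def K_def)
  moreover have "N x = x * x powr (- b) * K x"
    using x(1) powr_add[of x 1 "- b"] by (simp add: N_def K_def kummer_second_solution_def)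
  ultimately have wronskian: "M x * N' - deriv M x * N x = (1 - b) * exp x * x powr (- b)"
    by (simp add: N'_def algebra_simps)
  have "M x \<noteq> 0"
    using x(2) by (simp add: M_def)
  then have quotient: "((\<lambda>x. (p * M x + q * N x) / M x) has_real_derivative
      q * (M x * N' - deriv M x * N x) / (M x)\<^sup>2) (at x)" for p q
    by (auto intro!: derivative_eq_intros M_deriv N_deriv simp: power2_eq_square algebra_simps)
  have "Gamma (b - 1) * rGamma a * (M x * N' - deriv M x * N x)
      = Gamma (b - 1) * (1 - b) * rGamma a * exp x * x powr (- b)"
    unfolding wronskian by (simp only: mult_ac)
  also have "Gamma (b - 1) * (1 - b) = - Gamma b"
    using Gamma_plus1[OF notin_Ints_imp_notin_nonpos_Ints(3)[OF b_notin_Ints]] by (simp add: algebra_simps)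
  finally have "Gamma (b - 1) * rGamma a * (M x * N' - deriv M x * N x)
      = - (Gamma b * rGamma a) * exp x * x powr (- b)"
    by simp
  then show ?thesis
    using quotient[of "Gamma (1 - b) * rGamma (a - b + 1)" "Gamma (b - 1) * rGamma a"]
    unfolding tricomiU_def M_def[symmetric] N_def[symmetric] by simp
qed

lemma kummer_second_solution_at_top:
  assumes "2 - b \<notin> \<int>\<^sub>\<le>\<^sub>0"
  shows "((\<lambda>x. kummer_second_solution a b x / (exp x * x powr (a - b)))
    \<longlongrightarrow> Gamma (2 - b) * rGamma (a - b + 1)) at_top"
proof (rule Lim_transform_eventually)
  show "((\<lambda>x. kummerM (a - b + 1) (2 - b) x / (exp x * x powr (a - b + 1 - (2 - b))))
      \<longlongrightarrow> Gamma (2 - b) * rGamma (a - b + 1)) at_top"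
    by (rule kummerM_at_top[OF assms])
  show "\<forall>\<^sub>F x in at_top. kummerM (a - b + 1) (2 - b) x / (exp x * x powr (a - b + 1 - (2 - b)))
      = kummer_second_solution a b x / (exp x * x powr (a - b))"
    using eventually_gt_at_top[of 0]
  proof eventually_elim
    case (elim x)
    have "x powr (a - b) = x powr (1 - b) * x powr (a - b + 1 - (2 - b))"
      by (simp flip: powr_add)
    then show ?case
      using elim by (simp add: kummer_second_solution_def)
  qed
qed

lemma tricomiU_exp_growth_cancels:
  assumes "b \<notin> \<int>"
  shows "((\<lambda>x. tricomiU a b x / (exp x * x powr (a - b))) \<longlongrightarrow> 0) at_top"
proof -
  note b_notin = notin_Ints_imp_notin_nonpos_Ints[OF assms]
  have "((\<lambda>x. Gamma (1 - b) * rGamma (a - b + 1) * (kummerM a b x / (exp x * x powr (a - b)))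
      + Gamma (b - 1) * rGamma a * (kummer_second_solution a b x / (exp x * x powr (a - b))))
      \<longlongrightarrow> Gamma (1 - b) * rGamma (a - b + 1) * (Gamma b * rGamma a)
        + Gamma (b - 1) * rGamma a * (Gamma (2 - b) * rGamma (a - b + 1))) at_top"
    by (intro tendsto_intros kummerM_at_top kummer_second_solution_at_top b_notin)
  moreover have "Gamma b = (b - 1) * Gamma (b - 1)" "Gamma (2 - b) = (1 - b) * Gamma (1 - b)"
    using Gamma_plus1[OF b_notin(3)] Gamma_plus1[OF b_notin(4)] by simp_all
  ultimately show ?thesis
    by (simp add: tricomiU_def add_divide_distrib algebra_simps)
qed

lemma lhopital_0_at_top:
  fixes f g :: "real \<Rightarrow> real"
  assumes f_0: "(f \<longlongrightarrow> 0) at_top"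
    and g_0: "(g \<longlongrightarrow> 0) at_top"
    and g_nonzero: "\<forall>\<^sub>F x in at_top. g x \<noteq> 0"
    and g'_nonzero: "\<forall>\<^sub>F x in at_top. g' x \<noteq> 0"
    and Df: "\<forall>\<^sub>F x in at_top. (f has_real_derivative f' x) (at x)"
    and Dg: "\<forall>\<^sub>F x in at_top. (g has_real_derivative g' x) (at x)"
    and lim: "filterlim (\<lambda>x. f' x / g' x) F at_top"
  shows "filterlim (\<lambda>x. f x / g x) F at_top"
proof -
  have inverse_deriv: "\<forall>\<^sub>F x in at_right 0.
      ((\<lambda>x. h (inverse x)) has_real_derivative - h' (inverse x) / x\<^sup>2) (at x)"
    if "\<forall>\<^sub>F x in at_top. (h has_real_derivative h' x) (at x)" for h h' :: "real \<Rightarrow> real"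
    unfolding eventually_at_right_to_top
    using that eventually_gt_at_top[of 0]
  proof eventually_elim
    case (elim x)
    have "(inverse has_real_derivative - (x\<^sup>2)) (at (inverse x))"
      using DERIV_inverse[of "inverse x"] elim by (simp add: power2_eq_square)
    from DERIV_chain2[OF _ this, of h "h' x"] show ?case
      using elim by (simp add: field_simps)
  qed
  have "filterlim (\<lambda>x. f (inverse x) / g (inverse x)) F (at_right 0)"
  proof (rule lhopital_right_0[OF _ _ _ _ inverse_deriv[OF Df] inverse_deriv[OF Dg]])
    have "\<forall>\<^sub>F x in at_right 0. f' (inverse x) / g' (inverse x)
        = (- f' (inverse x) / x\<^sup>2) / (- g' (inverse x) / x\<^sup>2)"
      using eventually_at_right_less[of 0] by eventually_elim simp
    then show "filterlim (\<lambda>x. (- f' (inverse x) / x\<^sup>2) / (- g' (inverse x) / x\<^sup>2)) F (at_right 0)"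
      using lim unfolding filterlim_at_top_to_right
      by (rule filterlim_mono_eventually[OF _ order_refl order_refl, rotated])
    show "\<forall>\<^sub>F x in at_right 0. - g' (inverse x) / x\<^sup>2 \<noteq> 0"
      unfolding eventually_at_right_to_top using g'_nonzero eventually_gt_at_top[of 0]
      by eventually_elim simp
  qed (use f_0 g_0 g_nonzero in \<open>simp_all add: filterlim_at_top_to_right eventually_at_right_to_top\<close>)
  then show ?thesis
    by (simp add: filterlim_at_top_to_right)
qed

lemma exp_minus_powr_has_derivative:
  fixes x c :: real
  assumes "x > 0"
  shows "((\<lambda>x. exp (- x) * x powr c) has_real_derivative (c / x - 1) * (exp (- x) * x powr c)) (at x)"
  using assms powr_diff[of x c 1] by (auto intro!: derivative_eq_intros simp: field_simps)

lemma Gamma_times_rGamma_nonzero: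
  fixes a b :: real
  assumes "a \<notin> \<int>\<^sub>\<le>\<^sub>0" "b \<notin> \<int>\<^sub>\<le>\<^sub>0"
  shows "Gamma b * rGamma a \<noteq> 0"
  using assms by (simp add: rGamma_eq_zero_iff Gamma_eq_zero_iff)

lemma kummerM_eventually_nonzero:
  assumes "a \<notin> \<int>\<^sub>\<le>\<^sub>0" "b \<notin> \<int>\<^sub>\<le>\<^sub>0"
  shows "\<forall>\<^sub>F x in at_top. kummerM a b x \<noteq> 0"
  using tendsto_imp_eventually_ne[OF kummerM_at_top[OF assms(2)] Gamma_times_rGamma_nonzero[OF assms]]
  by (rule eventually_mono) simp

lemma tricomiU_over_kummerM_tendsto_0:
  assumes b_notin_Ints: "b \<notin> \<int>" and a_notin: "a \<notin> \<int>\<^sub>\<le>\<^sub>0"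
  shows "((\<lambda>x. tricomiU a b x / kummerM a b x) \<longlongrightarrow> 0) at_top"
proof (rule Lim_transform_eventually)
  let ?e = "\<lambda>x. exp x * x powr (a - b)"
  note b_notin = notin_Ints_imp_notin_nonpos_Ints(1)[OF b_notin_Ints]
  show "((\<lambda>x. (tricomiU a b x / ?e x) / (kummerM a b x / ?e x)) \<longlongrightarrow> 0) at_top"
    using tendsto_divide[OF tricomiU_exp_growth_cancels[OF b_notin_Ints] kummerM_at_top[OF b_notin]
        Gamma_times_rGamma_nonzero[OF a_notin b_notin]]
    by (simp only: div_0)
  show "\<forall>\<^sub>F x in at_top. (tricomiU a b x / ?e x) / (kummerM a b x / ?e x) = tricomiU a b x / kummerM a b x"
    by (rule eventually_mono[OF eventually_gt_at_top[of 0]]) simp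
qed

lemma exp_over_kummerM_square_at_top:
  assumes b_notin: "b \<notin> \<int>\<^sub>\<le>\<^sub>0" and a_notin: "a \<notin> \<int>\<^sub>\<le>\<^sub>0"
  shows "((\<lambda>x. exp x * x powr (- b) / (kummerM a b x)\<^sup>2 / (exp (- x) * x powr (b - 2 * a)))
    \<longlongrightarrow> 1 / (Gamma b * rGamma a)\<^sup>2) at_top"
proof (rule Lim_transform_eventually)
  let ?e = "\<lambda>x. exp x * x powr (a - b)" and ?g = "\<lambda>x. exp (- x) * x powr (b - 2 * a)"
  show "((\<lambda>x. 1 / (kummerM a b x / ?e x)\<^sup>2) \<longlongrightarrow> 1 / (Gamma b * rGamma a)\<^sup>2) at_top"
    using Gamma_times_rGamma_nonzero[OF a_notin b_notin]
    by (intro tendsto_intros kummerM_at_top[OF b_notin]) auto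
  show "\<forall>\<^sub>F x in at_top. 1 / (kummerM a b x / ?e x)\<^sup>2 = exp x * x powr (- b) / (kummerM a b x)\<^sup>2 / ?g x"
    using eventually_gt_at_top[of 0]
  proof eventually_elim
    case (elim x)
    have "(x powr (a - b))\<^sup>2 * x powr (b - 2 * a) = x powr (- b)"
      by (simp add: power2_eq_square flip: powr_add)
    then have "(?e x)\<^sup>2 * ?g x = exp x * x powr (- b)"
      by (simp add: power2_eq_square exp_minus field_simps)
    then have "(?e x)\<^sup>2 = exp x * x powr (- b) / ?g x"
      using elim by (simp add: field_simps)
    then show ?case
      by (simp add: power_divide)
  qed
qed

lemma tricomiU_over_kummerM_at_top:
  assumes b_notin_Ints: "b \<notin> \<int>" and a_notin: "a \<notin> \<int>\<^sub>\<le>\<^sub>0"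
  shows "((\<lambda>x. tricomiU a b x / kummerM a b x / (exp (- x) * x powr (b - 2 * a)))
    \<longlongrightarrow> 1 / (Gamma b * rGamma a)) at_top"
proof -
  define C where "C = Gamma b * rGamma a"
  let ?M = "kummerM a b" and ?g = "\<lambda>x. exp (- x) * x powr (b - 2 * a)"
  let ?f' = "\<lambda>x. - C * exp x * x powr (- b) / (?M x)\<^sup>2"
  note b_notin = notin_Ints_imp_notin_nonpos_Ints(1)[OF b_notin_Ints]
  have C_nonzero: "C \<noteq> 0"
    unfolding C_def by (rule Gamma_times_rGamma_nonzero[OF a_notin b_notin])
  have factor_lim: "((\<lambda>x. (b - 2 * a) / x - 1) \<longlongrightarrow> - 1) at_top"
    by real_asymp
  show ?thesis
    unfolding C_def[symmetric]
  proof (rule lhopital_0_at_top[OF tricomiU_over_kummerM_tendsto_0[OF b_notin_Ints a_notin]])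
    show "(?g \<longlongrightarrow> 0) at_top"
      by real_asymp
    show "\<forall>\<^sub>F x in at_top. ?g x \<noteq> 0"
      by (rule eventually_mono[OF eventually_gt_at_top[of 0]]) simp
    have "\<forall>\<^sub>F x in at_top. (b - 2 * a) / x - 1 \<noteq> 0"
      using factor_lim by (rule tendsto_imp_eventually_ne) simp
    then show "\<forall>\<^sub>F x in at_top. ((b - 2 * a) / x - 1) * ?g x \<noteq> 0"
      using eventually_gt_at_top[of 0] by eventually_elim simp
    show "\<forall>\<^sub>F x in at_top. (?g has_real_derivative ((b - 2 * a) / x - 1) * ?g x) (at x)"
      using exp_minus_powr_has_derivative by (rule eventually_mono[OF eventually_gt_at_top[of 0]])
    show "\<forall>\<^sub>F x in at_top. ((\<lambda>x. tricomiU a b x / ?M x) has_real_derivative ?f' x) (at x)"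
      using kummerM_eventually_nonzero[OF a_notin b_notin] eventually_gt_at_top[of 0] unfolding C_def
      by eventually_elim (rule tricomiU_over_kummerM_has_derivative[OF b_notin_Ints])
    have "((\<lambda>x. - C * (exp x * x powr (- b) / (?M x)\<^sup>2 / ?g x) / ((b - 2 * a) / x - 1))
        \<longlongrightarrow> - C * (1 / C\<^sup>2) / - 1) at_top"
      unfolding C_def by (intro tendsto_intros exp_over_kummerM_square_at_top b_notin a_notin factor_lim) auto
    moreover have "- C * (1 / C\<^sup>2) / - 1 = 1 / C"
      using C_nonzero by (simp add: power2_eq_square)
    ultimately show "((\<lambda>x. ?f' x / (((b - 2 * a) / x - 1) * ?g x)) \<longlongrightarrow> 1 / C) at_top"
      by (simp add: mult_ac)
  qed
qed

theorem tricomiU_at_top: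
  assumes b_notin_Ints: "b \<notin> \<int>" and a_notin: "a \<notin> \<int>\<^sub>\<le>\<^sub>0"
  shows "((\<lambda>x. tricomiU a b x * x powr a) \<longlongrightarrow> 1) at_top"
proof (rule Lim_transform_eventually)
  let ?M = "kummerM a b" and ?e = "\<lambda>x. exp x * x powr (a - b)" and ?g = "\<lambda>x. exp (- x) * x powr (b - 2 * a)"
  note b_notin = notin_Ints_imp_notin_nonpos_Ints(1)[OF b_notin_Ints]
  have "1 / (Gamma b * rGamma a) * (Gamma b * rGamma a) = 1"
    using Gamma_times_rGamma_nonzero[OF a_notin b_notin] by simp
  then show "((\<lambda>x. tricomiU a b x / ?M x / ?g x * (?M x / ?e x)) \<longlongrightarrow> 1) at_top"
    using tendsto_mult[OF tricomiU_over_kummerM_at_top[OF b_notin_Ints a_notin] kummerM_at_top[OF b_notin, of a]]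
    by (simp only:)
  show "\<forall>\<^sub>F x in at_top. tricomiU a b x / ?M x / ?g x * (?M x / ?e x) = tricomiU a b x * x powr a"
    using kummerM_eventually_nonzero[OF a_notin b_notin] eventually_gt_at_top[of 0]
  proof eventually_elim
    case (elim x)
    have "x powr a * (x powr (b - 2 * a) * x powr (a - b)) = 1"
      using elim by (simp flip: powr_add)
    then show ?case
      using elim by (simp add: exp_minus field_simps)
  qed
qed

section \<open>Smooth functions\<close>

primrec times_differentiable :: "nat \<Rightarrow> (real \<Rightarrow> real) \<Rightarrow> bool" where
  "times_differentiable 0 f \<longleftrightarrow> True"
| "times_differentiable (Suc n) f \<longleftrightarrow> (\<forall>x. f differentiable (at x)) \<and> times_differentiable n (deriv f)"

lemma times_differentiable_iff:
  "times_differentiable n f \<longleftrightarrow> (\<forall>m<n. \<forall>x. (deriv ^^ m) f differentiable (at x))"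
  by (induction n arbitrary: f) (simp_all add: All_less_Suc2 funpow_swap1)

lemma smooth_real_iff_times_differentiable: "smooth_real f \<longleftrightarrow> (\<forall>n. times_differentiable n f)"
  by (auto simp: smooth_real_def times_differentiable_iff)

lemma times_differentiable_SucI:
  assumes "\<And>x. (f has_real_derivative f' x) (at x)" and "times_differentiable n f'"
  shows "times_differentiable (Suc n) f"
proof -
  have "deriv f = f'"
    using assms(1) by (intro ext DERIV_imp_deriv)
  then show ?thesis
    using assms by (auto simp: real_differentiable_def)
qed

lemma times_differentiable_SucD:
  assumes "times_differentiable (Suc n) f"
  shows "(f has_real_derivative deriv f x) (at x)" and "times_differentiable n (deriv f)"
  using assms by (simp_all add: DERIV_deriv_iff_real_differentiable)

lemma times_differentiable_Suc_imp:
  assumes "times_differentiable (Suc n) f"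
  shows "times_differentiable n f"
  using assms by (simp add: times_differentiable_iff)

declare times_differentiable.simps(2) [simp del]

lemma times_differentiable_const: "times_differentiable n (\<lambda>_. c)"
  by (induction n arbitrary: c) (auto intro: times_differentiable_SucI[OF DERIV_const])

lemma times_differentiable_ident: "times_differentiable n (\<lambda>x. x)"
  by (cases n) (auto intro: times_differentiable_SucI[OF DERIV_ident times_differentiable_const])

lemma times_differentiable_add:
  assumes "times_differentiable n f" "times_differentiable n g"
  shows "times_differentiable n (\<lambda>x. f x + g x)"
  using assms
proof (induction n arbitrary: f g)
  case (Suc n)
  note f = times_differentiable_SucD[OF Suc.prems(1)] and g = times_differentiable_SucD[OF Suc.prems(2)]
  show ?case
    by (rule times_differentiable_SucI[OF DERIV_add[OF f(1) g(1)] Suc.IH[OF f(2) g(2)]])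
qed simp

lemma times_differentiable_mult:
  assumes "times_differentiable n f" "times_differentiable n g"
  shows "times_differentiable n (\<lambda>x. f x * g x)"
  using assms
proof (induction n arbitrary: f g)
  case (Suc n)
  note f = times_differentiable_SucD[OF Suc.prems(1)] and g = times_differentiable_SucD[OF Suc.prems(2)]
  show ?case
    by (rule times_differentiable_SucI[OF DERIV_mult[OF f(1) g(1)]])
       (intro times_differentiable_add Suc.IH f(2) g(2) Suc.prems[THEN times_differentiable_Suc_imp])
qed simp

lemma times_differentiable_powr:
  assumes "times_differentiable n g" and pos: "\<And>x. g x > 0"
  shows "times_differentiable n (\<lambda>x. g x powr q)"
  using assms(1)
proof (induction n arbitrary: q)
  case (Suc n)
  note g = times_differentiable_SucD[OF Suc.prems]
  show ?case
  proof (rule times_differentiable_SucI)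
    show "((\<lambda>x. g x powr q) has_real_derivative q * g x powr (q - 1) * deriv g x) (at x)" for x
      using DERIV_fun_powr[OF g(1) pos] by simp
    show "times_differentiable n (\<lambda>x. q * g x powr (q - 1) * deriv g x)"
      by (intro times_differentiable_mult times_differentiable_const Suc.IH g(2)
          Suc.prems[THEN times_differentiable_Suc_imp])
  qed
qed simp

lemma times_differentiable_kummerM:
  assumes "times_differentiable n g" and "b \<notin> \<int>\<^sub>\<le>\<^sub>0"
  shows "times_differentiable n (\<lambda>x. kummerM a b (g x))"
  using assms
proof (induction n arbitrary: a b)
  case (Suc n)
  note g = times_differentiable_SucD[OF Suc.prems(1)]
  have "b + 1 \<notin> \<int>\<^sub>\<le>\<^sub>0"
    using plus_one_in_nonpos_Ints_imp Suc.prems(2) by blast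
  then have "times_differentiable n (\<lambda>x. a / b * kummerM (a + 1) (b + 1) (g x) * deriv g x)"
    by (intro times_differentiable_mult times_differentiable_const Suc.IH g(2)
        Suc.prems(1)[THEN times_differentiable_Suc_imp])
  then show ?case
    by (rule times_differentiable_SucI[OF DERIV_chain2[OF has_real_derivative_kummerM[OF Suc.prems(2)] g(1)]])
qed simp

lemma smooth_real_imp_continuous_on:
  assumes "smooth_real f"
  shows "continuous_on UNIV f"
proof -
  have "f differentiable (at x)" for x
    using assms[unfolded smooth_real_def, rule_format, of 0] by simp
  then show ?thesis
    by (intro continuous_at_imp_continuous_on ballI differentiable_imp_continuous_within)
qed

lemma bounded_range_if_tendsto:
  fixes f :: "real \<Rightarrow> 'a :: metric_space"
  assumes cont: "continuous_on UNIV f"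
    and bot: "(f \<longlongrightarrow> l) at_bot" and top: "(f \<longlongrightarrow> u) at_top"
  shows "bounded (range f)"
proof -
  obtain A where A: "\<And>t. t \<le> A \<Longrightarrow> dist (f t) l < 1"
    using tendstoD[OF bot zero_less_one] by (auto simp: eventually_at_bot_linorder)
  obtain B where B: "\<And>t. t \<ge> B \<Longrightarrow> dist (f t) u < 1"
    using tendstoD[OF top zero_less_one] by (auto simp: eventually_at_top_linorder)
  have "bounded (f ` {A..B})"
    by (intro compact_imp_bounded compact_continuous_image continuous_on_subset[OF cont]) auto
  then have "bounded (ball l 1 \<union> ball u 1 \<union> f ` {A..B})"
    by auto
  moreover have "range f \<subseteq> ball l 1 \<union> ball u 1 \<union> f ` {A..B}"
  proof
    fix y assume "y \<in> range f"
    then obtain t where "y = f t" by blast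
    then show "y \<in> ball l 1 \<union> ball u 1 \<union> f ` {A..B}"
      using A[of t] B[of t] by (cases "t \<le> A"; cases "t \<ge> B") (auto simp: dist_commute)
  qed
  ultimately show ?thesis by (rule bounded_subset)
qed

section \<open>Similarity solutions of \<open>z v\<^sub>x = v\<^sub>z\<^sub>z\<close>\<close>

definition cubic_ode :: "real \<Rightarrow> (real \<Rightarrow> real) \<Rightarrow> (real \<Rightarrow> real) \<Rightarrow> bool" where
  "cubic_ode a w w' \<longleftrightarrow> (\<forall>t. (w has_real_derivative w' t) (at t) \<and>
     (w' has_real_derivative - t * (t / 3 * w' t + a * w t)) (at t))"

lemma cubic_odeD:
  assumes "cubic_ode a w w'"
  shows "(w has_real_derivative w' t) (at t)"
    and "(w' has_real_derivative - t * (t / 3 * w' t + a * w t)) (at t)"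
  using assms by (auto simp: cubic_ode_def)

lemma cubic_ode_lincomb:
  assumes u: "cubic_ode a u u'" and w: "cubic_ode a w w'"
  shows "cubic_ode a (\<lambda>t. p * u t + q * w t) (\<lambda>t. p * u' t + q * w' t)"
  unfolding cubic_ode_def
  by (auto intro!: derivative_eq_intros cubic_odeD[OF u] cubic_odeD[OF w] simp: field_simps)

definition similarity_solution :: "real \<Rightarrow> (real \<Rightarrow> real) \<Rightarrow> real \<Rightarrow> real \<Rightarrow> real" where
  "similarity_solution a w x z = x powr (- a) * w (z * x powr (-1/3))"

lemma similarity_solution_has_derivative_x:
  fixes z :: real
  assumes w: "cubic_ode a w w'" and x: "x > 0"
  defines "t \<equiv> z * x powr (-1/3)"
  shows "((\<lambda>x. similarity_solution a w x z) has_real_derivative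
    - (x powr (- a) / x * (t / 3 * w' t + a * w t))) (at x)"
proof -
  have powr_deriv: "((\<lambda>x. x powr c) has_real_derivative c * (x powr c / x)) (at x)" for c
    using has_real_derivative_powr[OF x, of c] x by (simp add: powr_diff)
  have "((\<lambda>x. z * x powr (-1/3)) has_real_derivative - (t / (3 * x))) (at x)"
    unfolding t_def by (rule DERIV_cong[OF DERIV_cmult[OF powr_deriv]]) simp
  then have "((\<lambda>x. w (z * x powr (-1/3))) has_real_derivative w' t * - (t / (3 * x))) (at x)"
    unfolding t_def by (rule DERIV_chain2[OF cubic_odeD(1)[OF w]])
  from DERIV_mult[OF powr_deriv this, of "- a"] show ?thesis
    unfolding similarity_solution_def
  proof (rule DERIV_cong)
    show "- a * (x powr (- a) / x) * w (z * x powr (-1/3)) + w' t * - (t / (3 * x)) * x powr (- a)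
        = - (x powr (- a) / x * (t / 3 * w' t + a * w t))"
      unfolding t_def[symmetric] using x by (simp add: field_simps)
  qed
qed

lemma similarity_solution_has_derivative_z:
  assumes w: "cubic_ode a w w'"
  shows "((\<lambda>z. similarity_solution a w x z) has_real_derivative
    x powr (- a) * (w' (z * x powr (-1/3)) * x powr (-1/3))) (at z)"
  unfolding similarity_solution_def
  by (intro DERIV_cmult DERIV_chain2[OF cubic_odeD(1)[OF w]]) (auto intro!: derivative_eq_intros)

lemma deriv_similarity_solution_z_has_derivative:
  fixes z :: real
  assumes w: "cubic_ode a w w'" and x: "x > 0"
  defines "t \<equiv> z * x powr (-1/3)"
  shows "(deriv (\<lambda>z. similarity_solution a w x z) has_real_derivative
    - (z * (x powr (- a) / x * (t / 3 * w' t + a * w t)))) (at z)"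
proof -
  let ?y = "x powr (-1/3)"
  have y_cube: "?y * ?y * ?y = 1 / x"
    using x by (simp add: powr_minus_divide flip: powr_add)
  have "deriv (\<lambda>z. similarity_solution a w x z) = (\<lambda>z. x powr (- a) * (w' (z * ?y) * ?y))"
    using similarity_solution_has_derivative_z[OF w] by (intro ext DERIV_imp_deriv)
  moreover have "((\<lambda>z. x powr (- a) * (w' (z * ?y) * ?y)) has_real_derivative
      x powr (- a) * ((- t * (t / 3 * w' t + a * w t)) * ?y * ?y)) (at z)"
    unfolding t_def
    by (intro DERIV_cmult DERIV_cmult_right DERIV_chain2[OF cubic_odeD(2)[OF w]])
       (auto intro!: derivative_eq_intros)
  moreover have "x powr (- a) * ((- t * (t / 3 * w' t + a * w t)) * ?y * ?y)
      = - (z * x powr (- a) * (?y * ?y * ?y) * (t / 3 * w' t + a * w t))"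
    unfolding t_def by (simp only: mult_minus_left mult_minus_right mult_ac)
  ultimately show ?thesis
    unfolding y_cube by (simp add: mult_ac)
qed

theorem similarity_solution_pde:
  assumes "cubic_ode a w w'" and "x > 0"
  shows "z * deriv (\<lambda>x. similarity_solution a w x z) x
    - deriv (deriv (\<lambda>z. similarity_solution a w x z)) z = 0"
  unfolding DERIV_imp_deriv[OF similarity_solution_has_derivative_x[OF assms]]
    DERIV_imp_deriv[OF deriv_similarity_solution_z_has_derivative[OF assms]] by simp

lemma cubic_ode_kummerM:
  "cubic_ode a (\<lambda>t. kummerM a (2/3) (- (t^3) / 9))
    (\<lambda>t. - (t\<^sup>2) / 3 * deriv (kummerM a (2/3)) (- (t^3) / 9))"
proof -
  define M where "M = kummerM a (2/3)"
  have b_notin: "(2/3 :: real) \<notin> \<int>\<^sub>\<le>\<^sub>0"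
    by (auto elim!: nonpos_Ints_cases)
  note M_deriv = kummerM_has_deriv[OF b_notin, of a, folded M_def]
  show ?thesis
    unfolding cubic_ode_def M_def[symmetric]
  proof (intro allI conjI)
    fix t :: real
    define z where "z = - (t^3) / 9"
    have z_deriv: "((\<lambda>t. - (t^3) / 9) has_real_derivative - (t\<^sup>2) / 3) (at t)"
      by (auto intro!: derivative_eq_intros)
    show "((\<lambda>t. M (- (t^3) / 9)) has_real_derivative - (t\<^sup>2) / 3 * deriv M (- (t^3) / 9)) (at t)"
      using DERIV_chain2[OF M_deriv(1) z_deriv] by (simp add: mult.commute)
    have "((\<lambda>t. - (t\<^sup>2) / 3 * deriv M (- (t^3) / 9)) has_real_derivative
        - t * (2/3 * deriv M z - t^3 / 9 * deriv (deriv M) z)) (at t)"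
    proof (rule DERIV_cong[OF DERIV_mult[OF _ DERIV_chain2[OF M_deriv(2) z_deriv]]])
      show "((\<lambda>t. - (t\<^sup>2) / 3) has_real_derivative - 2/3 * t) (at t)"
        by (auto intro!: derivative_eq_intros)
    qed (simp add: z_def field_simps power2_eq_square power3_eq_cube)
    moreover have "2/3 * deriv M z - t^3 / 9 * deriv (deriv M) z
        = t / 3 * (- (t\<^sup>2) / 3 * deriv M z) + a * M z"
      using kummer_equation[OF b_notin, of z a, folded M_def]
      by (simp add: z_def field_simps power2_eq_square power3_eq_cube)
    ultimately show "((\<lambda>t. - (t\<^sup>2) / 3 * deriv M (- (t^3) / 9)) has_real_derivative
        - t * (t / 3 * (- (t\<^sup>2) / 3 * deriv M (- (t^3) / 9)) + a * M (- (t^3) / 9))) (at t)"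
      by (simp add: z_def)
  qed
qed

lemma cubic_ode_times_kummerM:
  "cubic_ode a (\<lambda>t. t * kummerM (a + 1/3) (4/3) (- (t^3) / 9))
    (\<lambda>t. kummerM (a + 1/3) (4/3) (- (t^3) / 9) - t^3 / 3 * deriv (kummerM (a + 1/3) (4/3)) (- (t^3) / 9))"
proof -
  define M where "M = kummerM (a + 1/3) (4/3)"
  have b_notin: "(4/3 :: real) \<notin> \<int>\<^sub>\<le>\<^sub>0"
    by (auto elim!: nonpos_Ints_cases)
  note M_deriv = kummerM_has_deriv[OF b_notin, of "a + 1/3", folded M_def]
  show ?thesis
    unfolding cubic_ode_def M_def[symmetric]
  proof (intro allI conjI)
    fix t :: real
    define z where "z = - (t^3) / 9"
    have z_deriv: "((\<lambda>t. - (t^3) / 9) has_real_derivative - (t\<^sup>2) / 3) (at t)"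
      by (auto intro!: derivative_eq_intros)
    note Mz_deriv = DERIV_chain2[OF M_deriv(1) z_deriv] DERIV_chain2[OF M_deriv(2) z_deriv]
    show "((\<lambda>t. t * M (- (t^3) / 9)) has_real_derivative
        M (- (t^3) / 9) - t^3 / 3 * deriv M (- (t^3) / 9)) (at t)"
      by (rule DERIV_cong[OF DERIV_mult[OF DERIV_ident Mz_deriv(1)]])
         (simp add: power2_eq_square power3_eq_cube)
    have "((\<lambda>t. M (- (t^3) / 9) - t^3 / 3 * deriv M (- (t^3) / 9)) has_real_derivative
        - (t\<^sup>2) * (4/3 * deriv M z - t^3 / 9 * deriv (deriv M) z)) (at t)"
    proof (rule DERIV_cong[OF DERIV_diff[OF Mz_deriv(1) DERIV_mult[OF _ Mz_deriv(2)]]])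
      show "((\<lambda>t. t^3 / 3) has_real_derivative t\<^sup>2) (at t)"
        by (auto intro!: derivative_eq_intros)
    qed (simp add: z_def field_simps power2_eq_square power3_eq_cube)
    moreover have "4/3 * deriv M z - t^3 / 9 * deriv (deriv M) z
        = - (t^3) / 9 * deriv M z + (a + 1/3) * M z"
      using kummer_equation[OF b_notin, of z "a + 1/3", folded M_def]
      by (simp add: z_def field_simps)
    moreover have "- (t\<^sup>2) * (- (t^3) / 9 * deriv M z + (a + 1/3) * M z)
        = - t * (t / 3 * (M z - t^3 / 3 * deriv M z) + a * (t * M z))"
      by (simp add: field_simps power2_eq_square power3_eq_cube)
    ultimately show "((\<lambda>t. M (- (t^3) / 9) - t^3 / 3 * deriv M (- (t^3) / 9)) has_real_derivative
        - t * (t / 3 * (M (- (t^3) / 9) - t^3 / 3 * deriv M (- (t^3) / 9)) + a * (t * M (- (t^3) / 9)))) (at t)"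
      by (simp add: z_def)
  qed
qed

section \<open>The profile of the similarity solutions\<close>

text \<open>The continuation of \<open>t \<mapsto> U(a, 2/3, -t\<^sup>3/9)\<close> from \<open>t < 0\<close> to the real line.\<close>

definition tricomi_profile :: "real \<Rightarrow> real \<Rightarrow> real" where
  "tricomi_profile a t = Gamma (1/3) * rGamma (a + 1/3) * kummerM a (2/3) (- (t^3) / 9)
     - Gamma (-1/3) * rGamma a * (t / 9 powr (1/3)) * kummerM (a + 1/3) (4/3) (- (t^3) / 9)"

lemma cubic_ode_tricomi_profile: "\<exists>w'. cubic_ode a (tricomi_profile a) w'"
proof -
  let ?p = "Gamma (1/3) * rGamma (a + 1/3)" and ?q = "- (Gamma (-1/3) * rGamma a / 9 powr (1/3))"
  have profile_eq: "tricomi_profile a = (\<lambda>t. ?p * kummerM a (2/3) (- (t^3) / 9)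
      + ?q * (t * kummerM (a + 1/3) (4/3) (- (t^3) / 9)))"
    by (simp add: fun_eq_iff tricomi_profile_def)
  show ?thesis
    unfolding profile_eq using cubic_ode_lincomb[OF cubic_ode_kummerM cubic_ode_times_kummerM] by blast
qed

lemma powr_third_cube_div_9:
  fixes s :: real
  assumes "s > 0"
  shows "(s^3 / 9) powr (1/3) = s / 9 powr (1/3)"
  using assms by (simp add: powr_divide powr_powr flip: powr_numeral)

lemma tricomi_profile_minus:
  assumes "s > 0"
  shows "tricomi_profile a (- s) = tricomiU a (2/3) (s^3 / 9)"
  by (simp add: tricomi_profile_def tricomiU_def kummer_second_solution_def
      powr_third_cube_div_9[OF assms] add.commute)

lemma two_thirds_not_Ints: "(2/3 :: real) \<notin> \<int>"
  using fraction_not_in_Ints[where 'a = real, of 3 2] by simp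

lemma cube_div_9_at_top: "filterlim (\<lambda>s::real. s^3 / 9) at_top at_top"
  by real_asymp

lemma tricomi_profile_at_bot:
  assumes "a \<notin> \<int>\<^sub>\<le>\<^sub>0"
  shows "((\<lambda>s. tricomi_profile a (- s) * (s^3 / 9) powr a) \<longlongrightarrow> 1) at_top"
proof (rule Lim_transform_eventually)
  show "((\<lambda>s. tricomiU a (2/3) (s^3 / 9) * (s^3 / 9) powr a) \<longlongrightarrow> 1) at_top"
    by (rule filterlim_compose[OF tricomiU_at_top[OF two_thirds_not_Ints assms] cube_div_9_at_top])
  show "\<forall>\<^sub>F s in at_top. tricomiU a (2/3) (s^3 / 9) * (s^3 / 9) powr a
      = tricomi_profile a (- s) * (s^3 / 9) powr a"
    by (rule eventually_mono[OF eventually_gt_at_top[of 0]]) (simp add: tricomi_profile_minus)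
qed

lemma rGamma_reflection_real:
  fixes x :: real
  shows "rGamma x * rGamma (1 - x) = sin (pi * x) / pi"
proof -
  have "complex_of_real (rGamma x * rGamma (1 - x))
      = rGamma (complex_of_real x) * rGamma (1 - complex_of_real x)"
    using rGamma_complex_of_real[of x] rGamma_complex_of_real[of "1 - x"] by simp
  also have "\<dots> = complex_of_real (sin (pi * x) / pi)"
    using sin_of_real[of "pi * x", where 'a = complex] by (simp add: rGamma_reflection_complex)
  finally show ?thesis
    by (simp only: of_real_eq_iff)
qed

lemma tricomi_profile_connection_coefficient:
  "Gamma (1/3) * rGamma (a + 1/3) * (Gamma (2/3) * rGamma (2/3 - a))
    - Gamma (-1/3) * rGamma a * (Gamma (4/3) * rGamma (1 - a)) = 2 * sin (pi * (a + 1/6))"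
  (is "?lhs = _")
proof -
  have Gamma_shift: "Gamma (-1/3) = - 3 * Gamma (2/3 :: real)" "Gamma (4/3) = Gamma (1/3) / (3 :: real)"
    using Gamma_plus1[of "-1/3 :: real"] Gamma_plus1[of "1/3 :: real"]
      notin_Ints_imp_notin_nonpos_Ints[OF two_thirds_not_Ints] by simp_all
  have "rGamma (1/3) * rGamma (2/3) = sin (pi / 3) / (pi :: real)"
    using rGamma_reflection_real[of "1/3"] by simp
  then have "1 / (Gamma (1/3) * Gamma (2/3)) = sin (pi / 3) / (pi :: real)"
    by (simp add: rGamma_inverse_Gamma inverse_eq_divide)
  then have Gamma_product: "Gamma (1/3) * Gamma (2/3) = pi / sin (pi / 3)"
    by (metis divide_divide_eq_right div_by_1 mult_1)
  have "?lhs = Gamma (1/3) * Gamma (2/3) *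
      (rGamma (a + 1/3) * rGamma (1 - (a + 1/3)) + rGamma a * rGamma (1 - a))"
    unfolding Gamma_shift by (simp add: algebra_simps)
  also have "\<dots> = Gamma (1/3) * Gamma (2/3) / pi * (sin (pi * (a + 1/3)) + sin (pi * a))"
    by (simp only: rGamma_reflection_real) (simp add: field_simps)
  also have "sin (pi * (a + 1/3)) + sin (pi * a) = 2 * sin (pi * (a + 1/6)) * sin (pi / 3)"
  proof -
    have "(pi * (a + 1/3) + pi * a) / 2 = pi * (a + 1/6)" "(pi * (a + 1/3) - pi * a) / 2 = pi / 6"
      by (simp_all add: field_simps)
    then show ?thesis
      by (simp only: sin_plus_sin) (simp add: sin_60 cos_30)
  qed
  also have "Gamma (1/3) * Gamma (2/3) / pi * (2 * sin (pi * (a + 1/6)) * sin (pi / 3))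
      = 2 * sin (pi * (a + 1/6))"
    unfolding Gamma_product by (simp add: sin_60)
  finally show ?thesis .
qed

lemma tricomi_profile_at_top:
  "((\<lambda>s. tricomi_profile a s * (s^3 / 9) powr a) \<longlongrightarrow> 2 * sin (pi * (a + 1/6))) at_top"
proof (rule Lim_transform_eventually)
  let ?M1 = "\<lambda>x. kummerM a (2/3) (- x) * x powr a"
  let ?M2 = "\<lambda>x. kummerM (a + 1/3) (4/3) (- x) * x powr (a + 1/3)"
  let ?W = "\<lambda>x. Gamma (1/3) * rGamma (a + 1/3) * ?M1 x - Gamma (-1/3) * rGamma a * ?M2 x"
  have b_notin: "(2/3 :: real) \<notin> \<int>\<^sub>\<le>\<^sub>0" "(4/3 :: real) \<notin> \<int>\<^sub>\<le>\<^sub>0"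
    using notin_Ints_imp_notin_nonpos_Ints[OF two_thirds_not_Ints] by simp_all
  have "(?W \<longlongrightarrow> Gamma (1/3) * rGamma (a + 1/3) * (Gamma (2/3) * rGamma (2/3 - a))
        - Gamma (-1/3) * rGamma a * (Gamma (4/3) * rGamma (4/3 - (a + 1/3)))) at_top"
    by (intro tendsto_intros kummerM_minus_at_top b_notin)
  then have "(?W \<longlongrightarrow> 2 * sin (pi * (a + 1/6))) at_top"
    using tricomi_profile_connection_coefficient[of a] by simp
  then show "((\<lambda>s. ?W (s^3 / 9)) \<longlongrightarrow> 2 * sin (pi * (a + 1/6))) at_top"
    by (rule filterlim_compose[OF _ cube_div_9_at_top])
  show "\<forall>\<^sub>F s in at_top. ?W (s^3 / 9) = tricomi_profile a s * (s^3 / 9) powr a"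
    using eventually_gt_at_top[of 0]
    by eventually_elim (simp add: tricomi_profile_def powr_add powr_third_cube_div_9 algebra_simps)
qed

definition normalized_profile :: "real \<Rightarrow> real \<Rightarrow> real" where
  "normalized_profile a t = 9 powr (- a) * (1 + t\<^sup>2) powr (3 * a / 2) * tricomi_profile a t"

lemma normalized_profile_rescale:
  assumes "t \<noteq> 0"
  shows "normalized_profile a t
    = ((1 + t\<^sup>2) / t\<^sup>2) powr (3 * a / 2) * (tricomi_profile a t * (\<bar>t\<bar>^3 / 9) powr a)"
proof -
  have "(\<bar>t\<bar>\<^sup>2) powr (3 * a / 2) = \<bar>t\<bar> powr (3 * a)" "(\<bar>t\<bar>^3) powr a = \<bar>t\<bar> powr (3 * a)"
    by (simp_all only: powr_powr abs_ge_zero flip: powr_numeral) simp_all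
  moreover have "((1 + t\<^sup>2) / t\<^sup>2) powr (3 * a / 2) = (1 + t\<^sup>2) powr (3 * a / 2) / (t\<^sup>2) powr (3 * a / 2)"
    by (rule powr_divide)
  moreover have "(\<bar>t\<bar>^3 / 9) powr a = (\<bar>t\<bar>^3) powr a * 9 powr (- a)"
    by (simp add: powr_divide powr_minus_divide)
  ultimately show ?thesis
    using assms by (simp add: normalized_profile_def)
qed

lemma normalized_profile_tendsto:
  assumes lim: "((\<lambda>s. tricomi_profile a (\<sigma> * s) * (s^3 / 9) powr a) \<longlongrightarrow> L) at_top" and \<sigma>: "\<bar>\<sigma>\<bar> = 1"
  shows "((\<lambda>s. normalized_profile a (\<sigma> * s)) \<longlongrightarrow> L) at_top"
proof (rule Lim_transform_eventually)
  have "((\<lambda>s::real. ((1 + s\<^sup>2) / s\<^sup>2) powr (3 * a / 2)) \<longlongrightarrow> 1) at_top"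
    by real_asymp
  from tendsto_mult[OF this lim]
  show "((\<lambda>s. ((1 + s\<^sup>2) / s\<^sup>2) powr (3 * a / 2) *
      (tricomi_profile a (\<sigma> * s) * (s^3 / 9) powr a)) \<longlongrightarrow> L) at_top"
    by simp
  have \<sigma>_square: "\<sigma>\<^sup>2 = 1"
    using \<sigma> by (simp add: abs_square_eq_1)
  show "\<forall>\<^sub>F s in at_top. ((1 + s\<^sup>2) / s\<^sup>2) powr (3 * a / 2) * (tricomi_profile a (\<sigma> * s) * (s^3 / 9) powr a)
      = normalized_profile a (\<sigma> * s)"
    using eventually_gt_at_top[of 0]
  proof eventually_elim
    case (elim s)
    then have "\<sigma> * s \<noteq> 0" "\<bar>\<sigma> * s\<bar> = s" "(\<sigma> * s)\<^sup>2 = s\<^sup>2"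
      using \<sigma> \<sigma>_square by (auto simp: abs_mult power_mult_distrib)
    then show ?case
      by (simp add: normalized_profile_rescale)
  qed
qed

lemma normalized_profile_at_bot:
  assumes "a \<notin> \<int>\<^sub>\<le>\<^sub>0"
  shows "(normalized_profile a \<longlongrightarrow> 1) at_bot"
proof -
  have "((\<lambda>s. normalized_profile a (- 1 * s)) \<longlongrightarrow> 1) at_top"
    by (rule normalized_profile_tendsto) (use tricomi_profile_at_bot[OF assms] in simp_all)
  then show ?thesis
    by (simp add: filterlim_at_bot_mirror)
qed

lemma normalized_profile_at_top:
  "(normalized_profile a \<longlongrightarrow> 2 * sin (pi * (a + 1/6))) at_top"
proof -
  have "((\<lambda>s. normalized_profile a (1 * s)) \<longlongrightarrow> 2 * sin (pi * (a + 1/6))) at_top"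
    by (rule normalized_profile_tendsto)
       (use tricomi_profile_at_top[of a] in \<open>simp_all only: mult_1 abs_one\<close>)
  then show ?thesis by simp
qed

lemma smooth_normalized_profile: "smooth_real (normalized_profile a)"
proof -
  define c p q where "c = 9 powr (- a)" and "p = Gamma (1/3) * rGamma (a + 1/3)"
    and "q = - (Gamma (-1/3) * rGamma a / 9 powr (1/3))"
  have profile_eq: "normalized_profile a = (\<lambda>t. c * ((1 + t * t) powr (3 * a / 2) *
      (p * kummerM a (2/3) (- 1/9 * (t * (t * t)))
       + q * (t * kummerM (a + 1/3) (4/3) (- 1/9 * (t * (t * t)))))))"
    by (simp add: fun_eq_iff normalized_profile_def tricomi_profile_def c_def p_def q_def
        power2_eq_square power3_eq_cube mult_ac)
  have weight_pos: "0 < 1 + t * t" for t :: real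
    using zero_le_square[of t] by linarith
  have b_notin: "(2/3 :: real) \<notin> \<int>\<^sub>\<le>\<^sub>0" "(4/3 :: real) \<notin> \<int>\<^sub>\<le>\<^sub>0"
    using notin_Ints_imp_notin_nonpos_Ints[OF two_thirds_not_Ints] by simp_all
  show ?thesis
    unfolding smooth_real_iff_times_differentiable profile_eq
    by (intro allI times_differentiable_mult times_differentiable_add times_differentiable_powr
        times_differentiable_kummerM times_differentiable_const times_differentiable_ident weight_pos b_notin)
qed

section \<open>The functions \<open>\<Lambda>\<^sub>k\<close> and \<open>v\<^sub>k\<close>\<close>

lemma Lambda_eq_normalized_profile: "Lambda k = normalized_profile (- 1/6 - of_int k)"
proof
  fix t
  define a where "a = - 1/6 - real_of_int k"
  have "-1/4 - 3 * real_of_int k / 2 = 3 * a / 2" "1/6 + real_of_int k = - a"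
    "1/6 - real_of_int k = a + 1/3"
    by (simp_all add: a_def field_simps)
  then show "Lambda k t = normalized_profile a t"
    unfolding Lambda_def normalized_profile_def tricomi_profile_def a_def[symmetric]
    by (simp only: rGamma_inverse_Gamma) (simp add: field_simps)
qed

lemma vfun_eq_similarity_solution:
  fixes k :: int
  defines "a \<equiv> - 1/6 - of_int k"
  assumes x: "x > 0"
  shows "vfun k x z = similarity_solution a (\<lambda>t. 9 powr (- a) * tricomi_profile a t) x z"
proof -
  define t where "t = z * x powr (-1/3)"
  have weight_pos: "1 + t\<^sup>2 > 0"
    using zero_le_power2[of t] by linarith
  have "(x powr (-1/3))\<^sup>2 * x powr (2/3) = 1"
    using x by (simp add: power2_eq_square flip: powr_add)
  then have "z\<^sup>2 + x powr (2/3) = x powr (2/3) * (1 + t\<^sup>2)"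
    by (simp add: t_def power_mult_distrib distrib_left mult_ac)
  then have "sqrt (z\<^sup>2 + x powr (2/3)) = (x powr (2/3) * (1 + t\<^sup>2)) powr (1/2)"
    using weight_pos by (simp add: powr_half_sqrt)
  also have "\<dots> powr (- 3 * a) = x powr (- a) * (1 + t\<^sup>2) powr (- (3 * a / 2))"
    using weight_pos x by (simp add: powr_powr powr_mult)
  finally have radius: "sqrt (z\<^sup>2 + x powr (2/3)) powr (- 3 * a)
      = x powr (- a) * (1 + t\<^sup>2) powr (- (3 * a / 2))" .
  have exponent: "1/2 + 3 * real_of_int k = - 3 * a"
    by (simp add: a_def)
  have "(1 + t\<^sup>2) powr (- (3 * a / 2)) * (1 + t\<^sup>2) powr (3 * a / 2) = 1"
    using weight_pos by (simp flip: powr_add)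
  then show ?thesis
    unfolding vfun_def exponent radius t_def[symmetric] Lambda_eq_normalized_profile a_def[symmetric]
      normalized_profile_def similarity_solution_def
    by (simp add: mult_ac)
qed

lemma Lambda_at_bot: "(Lambda k \<longlongrightarrow> 1) at_bot"
proof -
  have "(- 1/6 - of_int k :: real) \<notin> \<int>"
    using fraction_not_in_Ints[where 'a = real, of 6 "-1"]
      Ints_add[of "- 1/6 - real_of_int k" "of_int k"] by auto
  then show ?thesis
    unfolding Lambda_eq_normalized_profile using nonpos_Ints_subset_Ints
    by (blast intro: normalized_profile_at_bot)
qed

lemma Lambda_at_top: "(Lambda k \<longlongrightarrow> 0) at_top"
proof -
  have "sin (pi * (- 1/6 - real_of_int k + 1/6)) = 0"
    using sin_times_pi_eq_0[of "- real_of_int k"] by (simp add: mult.commute)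
  then show ?thesis
    using normalized_profile_at_top[of "- 1/6 - of_int k"] by (simp add: Lambda_eq_normalized_profile)
qed

lemma smooth_Lambda: "smooth_real (Lambda k)"
  unfolding Lambda_eq_normalized_profile by (rule smooth_normalized_profile)

lemma vfun_pde:
  assumes x: "x > 0"
  shows "(\<lambda>x'. vfun k x' z) differentiable (at x)"
    and "(\<lambda>z''. vfun k x z'') differentiable (at z')"
    and "deriv (\<lambda>z'. vfun k x z') differentiable (at z)"
    and "z * deriv (\<lambda>x'. vfun k x' z) x - deriv (deriv (\<lambda>z'. vfun k x z')) z = 0"
proof -
  define a where "a = - 1/6 - real_of_int k"
  define w where "w t = 9 powr (- a) * tricomi_profile a t" for t
  obtain u' where profile_ode: "cubic_ode a (tricomi_profile a) u'"
    using cubic_ode_tricomi_profile by blast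
  have w_ode: "cubic_ode a w (\<lambda>t. 9 powr (- a) * u' t)"
    using cubic_ode_lincomb[OF profile_ode profile_ode, of "9 powr (- a)" 0] by (simp add: w_def[abs_def])
  have v_eq: "vfun k x' z' = similarity_solution a w x' z'" if "x' > 0" for x' z'
    using vfun_eq_similarity_solution[OF that] by (simp add: a_def w_def[abs_def])
  have near_x: "\<forall>\<^sub>F x' in nhds x. vfun k x' z = similarity_solution a w x' z"
    using eventually_nhds_in_open[of "{0<..}" x] x by (auto elim!: eventually_mono simp: v_eq)
  have v_eq_z: "(\<lambda>z. vfun k x z) = (\<lambda>z. similarity_solution a w x z)"
    using v_eq[OF x] by simp
  have Dx: "((\<lambda>x'. vfun k x' z) has_real_derivative deriv (\<lambda>x'. similarity_solution a w x' z) x) (at x)"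
    using similarity_solution_has_derivative_x[OF w_ode x, of z]
    by (simp add: DERIV_cong_ev[OF refl near_x refl] DERIV_imp_deriv)
  show "(\<lambda>x'. vfun k x' z) differentiable (at x)"
    using Dx real_differentiable_def by blast
  show "(\<lambda>z''. vfun k x z'') differentiable (at z')" "deriv (\<lambda>z'. vfun k x z') differentiable (at z)"
    unfolding v_eq_z real_differentiable_def
    using similarity_solution_has_derivative_z[OF w_ode]
      deriv_similarity_solution_z_has_derivative[OF w_ode x] by blast+
  show "z * deriv (\<lambda>x'. vfun k x' z) x - deriv (deriv (\<lambda>z'. vfun k x z')) z = 0"
    unfolding DERIV_imp_deriv[OF Dx] v_eq_z by (rule similarity_solution_pde[OF w_ode x])
qed

lemma vfun_tendsto_0:
  assumes "z > 0"
  shows "((\<lambda>x. vfun k x z) \<longlongrightarrow> 0) (at_right 0)"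
proof -
  have "((\<lambda>x. sqrt (z\<^sup>2 + x powr (2/3))) \<longlongrightarrow> sqrt (z\<^sup>2 + 0)) (at_right 0)"
  proof (intro tendsto_intros)
    show "((\<lambda>x::real. x powr (2/3)) \<longlongrightarrow> 0) (at_right 0)"
      by real_asymp
  qed
  then have "((\<lambda>x. sqrt (z\<^sup>2 + x powr (2/3)) powr (1/2 + 3 * of_int k))
      \<longlongrightarrow> z powr (1/2 + 3 * of_int k)) (at_right 0)"
    using assms by (intro tendsto_powr tendsto_const) auto
  moreover have "filterlim (\<lambda>x. z * x powr (-1/3)) at_top (at_right 0)"
    using assms by real_asymp
  then have "((\<lambda>x. Lambda k (z * x powr (-1/3))) \<longlongrightarrow> 0) (at_right 0)"
    by (rule filterlim_compose[OF Lambda_at_top])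
  ultimately have "((\<lambda>x. vfun k x z) \<longlongrightarrow> z powr (1/2 + 3 * of_int k) * 0) (at_right 0)"
    unfolding vfun_def by (rule tendsto_mult)
  then show ?thesis by simp
qed

theorem proposition2p13:
  fixes k :: int
  shows "smooth_real (Lambda k)
    \<and> bounded (range (Lambda k))
    \<and> (Lambda k \<longlongrightarrow> 1) at_bot
    \<and> (Lambda k \<longlongrightarrow> 0) at_top
    \<and> (\<forall>x z. x > 0 \<longrightarrow>
          (\<lambda>x'. vfun k x' z) differentiable (at x)
        \<and> (\<forall>z'. (\<lambda>z''. vfun k x z'') differentiable (at z'))
        \<and> deriv (\<lambda>z'. vfun k x z') differentiable (at z)
        \<and> z * deriv (\<lambda>x'. vfun k x' z) x - deriv (deriv (\<lambda>z'. vfun k x z')) z = 0)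
    \<and> (\<forall>z. z > 0 \<longrightarrow> ((\<lambda>x. vfun k x z) \<longlongrightarrow> 0) (at_right 0))"
proof -
  have "bounded (range (Lambda k))"
    by (intro bounded_range_if_tendsto[OF _ Lambda_at_bot Lambda_at_top]
        smooth_real_imp_continuous_on smooth_Lambda)
  then show ?thesis
    by (intro conjI allI impI smooth_Lambda Lambda_at_bot Lambda_at_top vfun_pde vfun_tendsto_0)
qed

end
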